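(* For every integer $n\geq 2$, none of the asymptotic cones of the higher-dimensional Thompson's group $nV$ has a cut-point.
   Context: **The groups $nV$.** Let $\mathfrak{C}=\{0,1\}^{\mathbb{N}}$ be the Cantor set of infinite words on $\{0,1\}$ (product topology). For finite words $w_1,\dots,w_n$ on $\{0,1\}$ (possibly empty), let $R(w_1,\dots,w_n)=\{(w_1\zeta_1,\dots,w_n\zeta_n)\mid \zeta_1,\dots,\zeta_n\in\mathfrak{C}\}\subset \mathfrak{C}^n$, where $w\zeta$ denotes concatenation; call such a set a rectangle. For $1\le i\le n$, the $i$-th subdivision of $R(w_1,\dots,w_n)$ replaces it by the two rectangles obtained by replacing $w_i$ by $w_i0$ and by $w_i1$, respectively. A pattern is a finite partition of $\mathfrak{C}^n$ into rectangles obtained from the trivial partition $\{\mathfrak{C}^n\}$ by finitely many successive subdivisions of individual rectangles (in any of the $n$ directions). A numbered pattern is a pattern with $m$ rectangles together with a numbering of its rectangles by $0,\dots,m-1$. Given two numbered patterns $P,P'$ with the same number $m$ of rectangles, where the rectangle numbered $j$ is $R(w_1^{(j)},\dots,w_n^{(j)})$ in $P$ and $R(u_1^{(j)},\dots,u_n^{(j)})$ in $P'$, one obtains a homeomorphism of $\mathfrak{C}^n$ by $(w_1^{(j)}\zeta_1,\dots,w_n^{(j)}\zeta_n)\mapsto (u_1^{(j)}\zeta_1,\dots,u_n^{(j)}\zeta_n)$ for all $j$ and all $\zeta_1,\dots,\zeta_n\in\mathfrak{C}$. The group $nV$ is the subgroup of $\mathrm{Homeo}(\mathfrak{C}^n)$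 consisting of all homeomorphisms obtained in this way from pairs of numbered patterns with the same number of rectangles. The groups $nV$ are known to be finitely generated (indeed finitely presented). The higher-dimensional Thompson's groups are $2V,3V,\dots$. **Asymptotic cones and cut-points.** For a finitely generated group $G$ with word metric $d$ with respect to a finite generating set, an asymptotic cone of $G$ is an ultralimit, with respect to a non-principal ultrafilter on $\mathbb{N}$, of the pointed metric spaces $(G, d/d_k, e_k)$, where $(e_k)$ is a sequence of base points in $G$ and $(d_k)$ is a sequence of positive real numbers tending to infinity. Such a cone is a geodesic metric space. A cut-point of a geodesic metric space $Y$ is a point $p\in Y$ such that $Y\setminus\{p\}$ is not (path-)connected. *)

theory Defs
  imports "HOL-Analysis.Analysis" "HOL-Algebra.Bij" "HOL-Algebra.Generated_Groups" "HOL-Library.Omega_Words_Fun"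
begin

section \<open>The groups nV\<close>

text \<open>Infinite binary words have type \<^typ>\<open>bool word\<close> (that is, functions from the naturals to
  the booleans), and \<open>w \<frown> x\<close> is concatenation. A point of the \<open>n\<close>-th power of the Cantor set is a
  function on the coordinates \<open>{..<n}\<close>, extensional outside them.\<close>

definition cantor_space :: "nat \<Rightarrow> (nat \<Rightarrow> bool word) topology" where
  "cantor_space n = product_topology (\<lambda>_. product_topology (\<lambda>_. discrete_topology UNIV) UNIV) {..<n}"

abbreviation cantor_power :: "nat \<Rightarrow> (nat \<Rightarrow> bool word) set" where
  "cantor_power n \<equiv> topspace (cantor_space n)"

lemma cantor_power_eq: "cantor_power n = (\<Pi>\<^sub>E i\<in>{..<n}. UNIV)"
  by (simp add: cantor_space_def)

definition homeo_group :: "'a topology \<Rightarrow> ('a \<Rightarrow> 'a) monoid" where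
  "homeo_group X =
     (BijGroup (topspace X))\<lparr>carrier := {f \<in> Bij (topspace X). homeomorphic_map X X f}\<rparr>"

text \<open>A tuple of finite words is a function \<open>w\<close>, of which only the values \<open>w i\<close> for \<open>i < n\<close> matter.\<close>

definition prefix_map :: "nat \<Rightarrow> (nat \<Rightarrow> bool list) \<Rightarrow> (nat \<Rightarrow> bool word) \<Rightarrow> (nat \<Rightarrow> bool word)" where
  "prefix_map n w \<zeta> = (\<lambda>i\<in>{..<n}. w i \<frown> \<zeta> i)"

definition rectangle :: "nat \<Rightarrow> (nat \<Rightarrow> bool list) \<Rightarrow> (nat \<Rightarrow> bool word) set" where
  "rectangle n w = prefix_map n w ` cantor_power n"

inductive pattern :: "nat \<Rightarrow> (nat \<Rightarrow> bool word) set set \<Rightarrow> bool" for n :: nat where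
  trivial: "pattern n {cantor_power n}"
| subdivide: "\<lbrakk>pattern n P; rectangle n w \<in> P; i < n\<rbrakk> \<Longrightarrow>
    pattern n ((P - {rectangle n w}) \<union>
      {rectangle n (w(i := w i @ [False])), rectangle n (w(i := w i @ [True]))})"

text \<open>A numbered pattern is given by the word tuples of its rectangles, in the order of the numbering.\<close>

definition numbered_pattern :: "nat \<Rightarrow> nat \<Rightarrow> (nat \<Rightarrow> nat \<Rightarrow> bool list) \<Rightarrow> bool" where
  "numbered_pattern n m w \<longleftrightarrow>
     (\<exists>P. pattern n P \<and> bij_betw (\<lambda>j. rectangle n (w j)) {..<m} P)"

definition nV :: "nat \<Rightarrow> ((nat \<Rightarrow> bool word) \<Rightarrow> (nat \<Rightarrow> bool word)) monoid" where
  "nV n = (homeo_group (cantor_space n))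
     \<lparr>carrier := {f \<in> carrier (homeo_group (cantor_space n)).
        \<exists>m w u. numbered_pattern n m w \<and> numbered_pattern n m u \<and>
          (\<forall>j<m. \<forall>\<zeta>\<in>cantor_power n. f (prefix_map n (w j) \<zeta>) = prefix_map n (u j) \<zeta>)}\<rparr>"


section \<open>Word metrics\<close>

definition word_length :: "('a, 'b) monoid_scheme \<Rightarrow> 'a set \<Rightarrow> 'a \<Rightarrow> nat" where
  "word_length G S g = (LEAST k. \<exists>xs. length xs = k \<and> set xs \<subseteq> S \<union> m_inv G ` S \<and>
     foldr (mult G) xs (one G) = g)"

text \<open>Off the carrier the distances below are set to zero, since the locale \<^locale>\<open>Metric_space\<close>
  asks for symmetry and nonnegativity on the whole type.\<close>

definition word_dist :: "('a, 'b) monoid_scheme \<Rightarrow> 'a set \<Rightarrow> 'a \<Rightarrow> 'a \<Rightarrow> real" where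
  "word_dist G S g h = (if g \<in> carrier G \<and> h \<in> carrier G
     then real (word_length G S (m_inv G g \<otimes>\<^bsub>G\<^esub> h)) else 0)"


section \<open>Ultralimits and asymptotic cones\<close>

text \<open>An ultrafilter is represented by the filter \<open>\<omega>\<close> whose eventually true predicates
  are the sets in the ultrafilter.\<close>

definition nonprincipal_ultrafilter :: "'i filter \<Rightarrow> bool" where
  "nonprincipal_ultrafilter \<omega> \<longleftrightarrow>
     \<omega> \<noteq> bot \<and>
     (\<forall>P. eventually P \<omega> \<or> eventually (\<lambda>i. \<not> P i) \<omega>) \<and>
     (\<forall>k. \<not> eventually (\<lambda>i. i = k) \<omega>)"

definition bounded_seqs ::
    "'i filter \<Rightarrow> ('i \<Rightarrow> 'a set) \<Rightarrow> ('i \<Rightarrow> 'a \<Rightarrow> 'a \<Rightarrow> real) \<Rightarrow> ('i \<Rightarrow> 'a) \<Rightarrow> ('i \<Rightarrow> 'a) set" where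
  "bounded_seqs \<omega> X d e =
     {x. (\<forall>k. x k \<in> X k) \<and> (\<exists>B. eventually (\<lambda>k. d k (x k) (e k) \<le> B) \<omega>)}"

definition ultralimit_rel ::
    "'i filter \<Rightarrow> ('i \<Rightarrow> 'a set) \<Rightarrow> ('i \<Rightarrow> 'a \<Rightarrow> 'a \<Rightarrow> real) \<Rightarrow> ('i \<Rightarrow> 'a) \<Rightarrow>
      (('i \<Rightarrow> 'a) \<times> ('i \<Rightarrow> 'a)) set" where
  "ultralimit_rel \<omega> X d e =
     {(x, y). x \<in> bounded_seqs \<omega> X d e \<and> y \<in> bounded_seqs \<omega> X d e \<and>
        ((\<lambda>k. d k (x k) (y k)) \<longlongrightarrow> 0) \<omega>}"

definition ultralimit ::
    "'i filter \<Rightarrow> ('i \<Rightarrow> 'a set) \<Rightarrow> ('i \<Rightarrow> 'a \<Rightarrow> 'a \<Rightarrow> real) \<Rightarrow> ('i \<Rightarrow> 'a) \<Rightarrow> ('i \<Rightarrow> 'a) set set" where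
  "ultralimit \<omega> X d e = bounded_seqs \<omega> X d e // ultralimit_rel \<omega> X d e"

definition ultralimit_dist ::
    "'i filter \<Rightarrow> ('i \<Rightarrow> 'a set) \<Rightarrow> ('i \<Rightarrow> 'a \<Rightarrow> 'a \<Rightarrow> real) \<Rightarrow> ('i \<Rightarrow> 'a) \<Rightarrow>
      ('i \<Rightarrow> 'a) set \<Rightarrow> ('i \<Rightarrow> 'a) set \<Rightarrow> real" where
  "ultralimit_dist \<omega> X d e a b =
     (if a \<in> ultralimit \<omega> X d e \<and> b \<in> ultralimit \<omega> X d e
      then THE r. \<exists>x\<in>a. \<exists>y\<in>b. ((\<lambda>k. d k (x k) (y k)) \<longlongrightarrow> r) \<omega> else 0)"

definition asymptotic_cone ::
    "('a, 'b) monoid_scheme \<Rightarrow> 'a set \<Rightarrow> nat filter \<Rightarrow> (nat \<Rightarrow> 'a) \<Rightarrow> (nat \<Rightarrow> real) \<Rightarrow>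
      (nat \<Rightarrow> 'a) set set" where
  "asymptotic_cone G S \<omega> e \<delta> =
     ultralimit \<omega> (\<lambda>_. carrier G) (\<lambda>k g h. word_dist G S g h / \<delta> k) e"

definition asymptotic_cone_dist ::
    "('a, 'b) monoid_scheme \<Rightarrow> 'a set \<Rightarrow> nat filter \<Rightarrow> (nat \<Rightarrow> 'a) \<Rightarrow> (nat \<Rightarrow> real) \<Rightarrow>
      (nat \<Rightarrow> 'a) set \<Rightarrow> (nat \<Rightarrow> 'a) set \<Rightarrow> real" where
  "asymptotic_cone_dist G S \<omega> e \<delta> =
     ultralimit_dist \<omega> (\<lambda>_. carrier G) (\<lambda>k g h. word_dist G S g h / \<delta> k) e"

definition cut_point :: "'a set \<Rightarrow> ('a \<Rightarrow> 'a \<Rightarrow> real) \<Rightarrow> 'a \<Rightarrow> bool" where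
  "cut_point Y d p \<longleftrightarrow> p \<in> Y \<and>
     \<not> path_connected_space (subtopology (Metric_space.mtopology Y d) (Y - {p}))"


text \<open>The ultralimit is a metric space, and its distance is the limit along \<open>\<omega>\<close> for all choices of
  representatives.\<close>

lemma nonprincipal_ultrafilter_convergent:
  fixes f :: "'i \<Rightarrow> real"
  assumes u: "nonprincipal_ultrafilter \<omega>" and b: "eventually (\<lambda>k. \<bar>f k\<bar> \<le> B) \<omega>"
  shows "\<exists>r. (f \<longlongrightarrow> r) \<omega>"
proof -
  have nb: "filtermap f \<omega> \<noteq> bot"
    using u by (simp add: nonprincipal_ultrafilter_def filtermap_bot_iff)
  have le: "eventually (\<lambda>x. x \<in> {-B..B}) (filtermap f \<omega>)"
    using b unfolding eventually_filtermap by (rule eventually_mono) auto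
  have "compact {-B..B}" by simp
  then obtain r where r: "r \<in> {-B..B}" "inf (nhds r) (filtermap f \<omega>) \<noteq> bot"
    using nb le unfolding compact_filter by blast
  have "(f \<longlongrightarrow> r) \<omega>"
  proof (rule topological_tendstoI)
    fix U assume U: "open U" "r \<in> U"
    show "eventually (\<lambda>x. f x \<in> U) \<omega>"
    proof (rule ccontr)
      assume "\<not> ?thesis"
      then have "eventually (\<lambda>x. f x \<notin> U) \<omega>"
        using u unfolding nonprincipal_ultrafilter_def by blast
      then have 1: "eventually (\<lambda>x. x \<notin> U) (filtermap f \<omega>)"
        by (simp add: eventually_filtermap)
      have 2: "eventually (\<lambda>x. x \<in> U) (nhds r)"
        using U by (simp add: eventually_nhds_in_open)
      have "eventually (\<lambda>x. False) (inf (nhds r) (filtermap f \<omega>))"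
        unfolding eventually_inf using 1 2 by blast
      then show False using r(2) by (simp add: eventually_False)
    qed
  qed
  then show ?thesis by blast
qed

context
  fixes \<omega> :: "'i filter" and X :: "'i \<Rightarrow> 'a set" and d :: "'i \<Rightarrow> 'a \<Rightarrow> 'a \<Rightarrow> real" and e :: "'i \<Rightarrow> 'a"
  assumes u: "nonprincipal_ultrafilter \<omega>"
    and m: "\<And>k. Metric_space (X k) (d k)"
    and e: "\<And>k. e k \<in> X k"
begin

lemma bounded_seqs_tendsto:
  assumes x: "x \<in> bounded_seqs \<omega> X d e" and y: "y \<in> bounded_seqs \<omega> X d e"
  shows "\<exists>r. ((\<lambda>k. d k (x k) (y k)) \<longlongrightarrow> r) \<omega>"
proof -
  obtain A B where xs: "\<And>k. x k \<in> X k" and ys: "\<And>k. y k \<in> X k"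
    and A: "eventually (\<lambda>k. d k (x k) (e k) \<le> A) \<omega>"
    and B: "eventually (\<lambda>k. d k (y k) (e k) \<le> B) \<omega>"
    using x y unfolding bounded_seqs_def by blast
  have "\<bar>d k (x k) (y k)\<bar> \<le> d k (x k) (e k) + d k (y k) (e k)" for k
    using Metric_space.triangle[OF m xs e ys, of k] Metric_space.nonneg[OF m, of k "x k" "y k"]
      Metric_space.commute[OF m, of k "e k" "y k"] by linarith
  then have "eventually (\<lambda>k. \<bar>d k (x k) (y k)\<bar> \<le> A + B) \<omega>"
    using eventually_conj[OF A B] by (elim eventually_mono) (smt (verit))
  then show ?thesis by (rule nonprincipal_ultrafilter_convergent[OF u])
qed

lemma ultralimit_rel_equiv: "equiv (bounded_seqs \<omega> X d e) (ultralimit_rel \<omega> X d e)"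
proof (rule equivI)
  show "ultralimit_rel \<omega> X d e \<subseteq> bounded_seqs \<omega> X d e \<times> bounded_seqs \<omega> X d e"
    by (auto simp: ultralimit_rel_def)
  have "x \<in> bounded_seqs \<omega> X d e \<Longrightarrow> d k (x k) (x k) = 0" for x k
    using Metric_space.zero[OF m, of "x k" k "x k"] by (auto simp: bounded_seqs_def)
  then show "refl_on (bounded_seqs \<omega> X d e) (ultralimit_rel \<omega> X d e)"
    by (auto simp: refl_on_def ultralimit_rel_def)
  show "sym (ultralimit_rel \<omega> X d e)"
    by (auto simp: sym_def ultralimit_rel_def Metric_space.commute[OF m])
  show "trans (ultralimit_rel \<omega> X d e)"
  proof (rule transI)
    fix x y z
    assume xy: "(x, y) \<in> ultralimit_rel \<omega> X d e" and yz: "(y, z) \<in> ultralimit_rel \<omega> X d e"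
    then have mem: "\<And>k. x k \<in> X k" "\<And>k. y k \<in> X k" "\<And>k. z k \<in> X k"
      by (auto simp: ultralimit_rel_def bounded_seqs_def)
    have "((\<lambda>k. d k (x k) (y k) + d k (y k) (z k)) \<longlongrightarrow> 0 + 0) \<omega>"
      using xy yz by (intro tendsto_add) (auto simp: ultralimit_rel_def)
    moreover have "norm (d k (x k) (z k)) \<le> d k (x k) (y k) + d k (y k) (z k)" for k
      using Metric_space.nonneg[OF m, of k "x k" "z k"] Metric_space.triangle[OF m mem] by simp
    ultimately have "((\<lambda>k. d k (x k) (z k)) \<longlongrightarrow> 0) \<omega>"
      by (rule_tac Lim_null_comparison[where g = "\<lambda>k. d k (x k) (y k) + d k (y k) (z k)", OF always_eventually]) auto
    then show "(x, z) \<in> ultralimit_rel \<omega> X d e"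
      using xy yz by (auto simp: ultralimit_rel_def)
  qed
qed

lemma ultralimit_rel_tendsto:
  assumes x: "(x, x') \<in> ultralimit_rel \<omega> X d e" and y: "(y, y') \<in> ultralimit_rel \<omega> X d e"
    and r: "((\<lambda>k. d k (x k) (y k)) \<longlongrightarrow> r) \<omega>"
  shows "((\<lambda>k. d k (x' k) (y' k)) \<longlongrightarrow> r) \<omega>"
proof -
  have mem: "\<And>k. x k \<in> X k" "\<And>k. x' k \<in> X k" "\<And>k. y k \<in> X k" "\<And>k. y' k \<in> X k"
    using x y by (auto simp: ultralimit_rel_def bounded_seqs_def)
  let ?s = "\<lambda>k. d k (x k) (x' k) + d k (y k) (y' k)"
  have s: "(?s \<longlongrightarrow> 0 + 0) \<omega>"
    using x y by (intro tendsto_add) (auto simp: ultralimit_rel_def)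
  have "\<bar>d k (x' k) (y' k) - d k (x k) (y k)\<bar> \<le> ?s k" for k
    using Metric_space.triangle[OF m, of "x k" k "x' k" "y k"]
      Metric_space.triangle[OF m, of "x' k" k "y' k" "y k"]
      Metric_space.triangle[OF m, of "x' k" k "x k" "y' k"]
      Metric_space.triangle[OF m, of "x k" k "y k" "y' k"]
      Metric_space.commute[OF m, of k "x k" "x' k"] Metric_space.commute[OF m, of k "y k" "y' k"] mem
    by (smt (verit))
  then have "((\<lambda>k. d k (x' k) (y' k) - d k (x k) (y k)) \<longlongrightarrow> 0) \<omega>"
    using s by (rule_tac Lim_null_comparison[where g = ?s, OF always_eventually]) auto
  from tendsto_add[OF this r] show ?thesis by simp
qed

lemma ultralimit_dist_tendsto:
  assumes a: "a \<in> ultralimit \<omega> X d e" and b: "b \<in> ultralimit \<omega> X d e"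
    and x: "x \<in> a" and y: "y \<in> b"
  shows "((\<lambda>k. d k (x k) (y k)) \<longlongrightarrow> ultralimit_dist \<omega> X d e a b) \<omega>"
proof -
  note q = quotient_eq_iff[OF ultralimit_rel_equiv]
  have sub: "x \<in> bounded_seqs \<omega> X d e" "y \<in> bounded_seqs \<omega> X d e"
    using assms in_quotient_imp_subset[OF ultralimit_rel_equiv] unfolding ultralimit_def by blast+
  then obtain r where r: "((\<lambda>k. d k (x k) (y k)) \<longlongrightarrow> r) \<omega>"
    using bounded_seqs_tendsto by blast
  have ne: "\<omega> \<noteq> bot" using u by (simp add: nonprincipal_ultrafilter_def)
  have "r' = r" if "x' \<in> a" "y' \<in> b" "((\<lambda>k. d k (x' k) (y' k)) \<longlongrightarrow> r') \<omega>" for x' y' r'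
  proof -
    have "(x', x) \<in> ultralimit_rel \<omega> X d e" "(y', y) \<in> ultralimit_rel \<omega> X d e"
      using q[of a a x' x] q[of b b y' y] a b x y that(1,2) by (simp_all add: ultralimit_def)
    from ultralimit_rel_tendsto[OF this that(3)] show ?thesis
      using tendsto_unique[OF ne _ r] by blast
  qed
  then have "(THE r. \<exists>x\<in>a. \<exists>y\<in>b. ((\<lambda>k. d k (x k) (y k)) \<longlongrightarrow> r) \<omega>) = r"
    by (rule_tac the_equality) (use r x y in blast)+
  then have "ultralimit_dist \<omega> X d e a b = r"
    using a b by (simp add: ultralimit_dist_def)
  then show ?thesis using r by simp
qed

lemma ultralimit_Metric_space: "Metric_space (ultralimit \<omega> X d e) (ultralimit_dist \<omega> X d e)"
proof -
  let ?U = "ultralimit \<omega> X d e" and ?D = "ultralimit_dist \<omega> X d e"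
  have ne: "\<omega> \<noteq> bot" using u by (simp add: nonprincipal_ultrafilter_def)
  have rep: "\<exists>x. x \<in> a" if "a \<in> ?U" for a
    using that in_quotient_imp_non_empty[OF ultralimit_rel_equiv] unfolding ultralimit_def by blast
  have sub: "x \<in> bounded_seqs \<omega> X d e" if "a \<in> ?U" "x \<in> a" for a x
    using that in_quotient_imp_subset[OF ultralimit_rel_equiv] unfolding ultralimit_def by blast
  have nn: "0 \<le> ?D a b" for a b
  proof (cases "a \<in> ?U \<and> b \<in> ?U")
    case True
    then obtain x y where xy: "x \<in> a" "y \<in> b" using rep by blast
    show ?thesis
      by (rule tendsto_lowerbound[OF ultralimit_dist_tendsto[of a b x y]])
        (use True xy ne Metric_space.nonneg[OF m] in auto)
  qed (auto simp: ultralimit_dist_def)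
  have comm: "?D a b = ?D b a" for a b
  proof (cases "a \<in> ?U \<and> b \<in> ?U")
    case True
    then obtain x y where xy: "x \<in> a" "y \<in> b" using rep by blast
    have "(\<lambda>k. d k (x k) (y k)) = (\<lambda>k. d k (y k) (x k))"
      using Metric_space.commute[OF m] by auto
    then show ?thesis
      using ultralimit_dist_tendsto[of a b x y] ultralimit_dist_tendsto[of b a y x] True xy
        tendsto_unique[OF ne] by auto
  qed (auto simp: ultralimit_dist_def)
  have zero: "?D a b = 0 \<longleftrightarrow> a = b" if ab: "a \<in> ?U" "b \<in> ?U" for a b
  proof -
    obtain x y where xy: "x \<in> a" "y \<in> b" using rep ab by blast
    have lim: "((\<lambda>k. d k (x k) (y k)) \<longlongrightarrow> ?D a b) \<omega>"
      by (rule ultralimit_dist_tendsto[OF ab xy])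
    have "a = b \<longleftrightarrow> (x, y) \<in> ultralimit_rel \<omega> X d e"
      using quotient_eq_iff[OF ultralimit_rel_equiv _ _ xy] ab unfolding ultralimit_def by blast
    also have "\<dots> \<longleftrightarrow> ((\<lambda>k. d k (x k) (y k)) \<longlongrightarrow> 0) \<omega>"
      using sub ab xy by (auto simp: ultralimit_rel_def)
    also have "\<dots> \<longleftrightarrow> ?D a b = 0"
      by (metis lim tendsto_unique[OF ne lim])
    finally show ?thesis by simp
  qed
  have tri: "?D a c \<le> ?D a b + ?D b c" if abc: "a \<in> ?U" "b \<in> ?U" "c \<in> ?U" for a b c
  proof -
    obtain x y z where xyz: "x \<in> a" "y \<in> b" "z \<in> c" using rep[OF abc(1)] rep[OF abc(2)] rep[OF abc(3)] by (elim exE)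
    have "x k \<in> X k" "y k \<in> X k" "z k \<in> X k" for k
      using sub[OF abc(1) xyz(1)] sub[OF abc(2) xyz(2)] sub[OF abc(3) xyz(3)]
      by (simp_all add: bounded_seqs_def)
    then have le: "d k (x k) (z k) \<le> d k (x k) (y k) + d k (y k) (z k)" for k
      using Metric_space.triangle[OF m] by blast
    have "((\<lambda>k. d k (x k) (y k) + d k (y k) (z k)) \<longlongrightarrow> ?D a b + ?D b c) \<omega>"
      by (rule tendsto_add[OF ultralimit_dist_tendsto[OF abc(1,2) xyz(1,2)]
            ultralimit_dist_tendsto[OF abc(2,3) xyz(2,3)]])
    from tendsto_le[OF ne this ultralimit_dist_tendsto[OF abc(1,3) xyz(1,3)]] le
    show ?thesis by simp
  qed
  show ?thesis
    by (rule Metric_space.intro) (fact nn comm zero tri)+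
qed

end

lemma word_dist_Metric_space:
  assumes "group G" and S: "S \<subseteq> carrier G" and gen: "generate G S = carrier G"
  shows "Metric_space (carrier G) (word_dist G S)"
proof -
  interpret group G by fact
  define W where "W = S \<union> m_inv G ` S"
  define ev where "ev xs = foldr (mult G) xs (one G)" for xs
  have WG: "W \<subseteq> carrier G" using S by (auto simp: W_def)
  have Winv: "inv\<^bsub>G\<^esub> x \<in> W" if "x \<in> W" for x using that S by (auto simp: W_def)
  have ev_closed: "ev xs \<in> carrier G" if "set xs \<subseteq> W" for xs
    using that WG by (induction xs) (auto simp: ev_def)
  have ev_append: "ev (xs @ ys) = ev xs \<otimes>\<^bsub>G\<^esub> ev ys" if "set xs \<subseteq> W" "set ys \<subseteq> W" for xs ys
    using that(1)
  proof (induction xs)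
    case Nil
    then show ?case using ev_closed[OF that(2)] by (simp add: ev_def)
  next
    case (Cons a xs)
    then have "a \<in> carrier G" "ev xs \<in> carrier G" "ev ys \<in> carrier G"
      using WG ev_closed that(2) by auto
    then show ?case using Cons by (auto simp: ev_def m_assoc)
  qed
  have ev_inv: "\<exists>ys. set ys \<subseteq> W \<and> length ys = length xs \<and> ev ys = inv\<^bsub>G\<^esub> (ev xs)"
    if "set xs \<subseteq> W" for xs
    using that
  proof (induction xs)
    case Nil
    then show ?case by (intro exI[of _ "[]"]) (simp add: ev_def)
  next
    case (Cons a xs)
    then obtain ys where ys: "set ys \<subseteq> W" "length ys = length xs" "ev ys = inv\<^bsub>G\<^esub> (ev xs)"
      by auto
    have mem: "a \<in> carrier G" "ev xs \<in> carrier G" "inv\<^bsub>G\<^esub> a \<in> W"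
      using Cons.prems WG ev_closed Winv by auto
    have "ev (ys @ [inv\<^bsub>G\<^esub> a]) = inv\<^bsub>G\<^esub> (ev xs) \<otimes>\<^bsub>G\<^esub> inv\<^bsub>G\<^esub> a"
      using ev_append[of ys "[inv\<^bsub>G\<^esub> a]"] ys mem by (simp add: ev_def)
    also have "\<dots> = inv\<^bsub>G\<^esub> (ev (a # xs))"
      using mem by (simp add: ev_def inv_mult_group)
    finally show ?case
      using ys mem by (intro exI[of _ "ys @ [inv\<^bsub>G\<^esub> a]"]) auto
  qed
  have ex: "\<exists>xs. set xs \<subseteq> W \<and> ev xs = g" if "g \<in> carrier G" for g
  proof -
    have "g \<in> generate G S" using that gen by simp
    then show ?thesis
    proof (induction rule: generate.induct)
      case one
      show ?case by (intro exI[of _ "[]"]) (simp add: ev_def)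
    next
      case (incl h)
      then show ?case using S by (intro exI[of _ "[h]"]) (auto simp: ev_def W_def)
    next
      case (inv h)
      then have "inv\<^bsub>G\<^esub> h \<in> W" by (auto simp: W_def)
      then show ?case using WG by (intro exI[of _ "[inv\<^bsub>G\<^esub> h]"]) (auto simp: ev_def)
    next
      case (eng h1 h2)
      then obtain xs ys where "set xs \<subseteq> W" "ev xs = h1" "set ys \<subseteq> W" "ev ys = h2" by blast
      then show ?case using ev_append by (intro exI[of _ "xs @ ys"]) auto
    qed
  qed
  have len: "word_length G S g = (LEAST k. \<exists>xs. length xs = k \<and> set xs \<subseteq> W \<and> ev xs = g)" for g
    by (simp add: word_length_def W_def ev_def)
  have le: "word_length G S (ev xs) \<le> length xs" if "set xs \<subseteq> W" for xs
    unfolding len using that by (intro Least_le) blast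
  have real: "\<exists>xs. length xs = word_length G S g \<and> set xs \<subseteq> W \<and> ev xs = g" if "g \<in> carrier G" for g
  proof -
    obtain xs where "set xs \<subseteq> W" "ev xs = g" using ex \<open>g \<in> carrier G\<close> by blast
    then have "\<exists>ys. length ys = length xs \<and> set ys \<subseteq> W \<and> ev ys = g" by blast
    then show ?thesis unfolding len by (rule LeastI)
  qed
  have len_inv: "word_length G S (inv\<^bsub>G\<^esub> g) \<le> word_length G S g" if "g \<in> carrier G" for g
  proof -
    obtain xs where xs: "length xs = word_length G S g" "set xs \<subseteq> W" "ev xs = g"
      using real \<open>g \<in> carrier G\<close> by blast
    then obtain ys where "set ys \<subseteq> W" "length ys = length xs" "ev ys = inv\<^bsub>G\<^esub> g"
      using ev_inv by blast
    then show ?thesis using le xs by metis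
  qed
  have len_mult: "word_length G S (g \<otimes>\<^bsub>G\<^esub> h) \<le> word_length G S g + word_length G S h"
    if g: "g \<in> carrier G" and h: "h \<in> carrier G" for g h
  proof -
    obtain xs ys where xs: "length xs = word_length G S g" "set xs \<subseteq> W" "ev xs = g"
      and ys: "length ys = word_length G S h" "set ys \<subseteq> W" "ev ys = h"
      using real[OF g] real[OF h] by blast
    have "set (xs @ ys) \<subseteq> W" using xs ys by simp
    from le[OF this] show ?thesis using xs ys ev_append by simp
  qed
  have len_0: "word_length G S g = 0 \<longleftrightarrow> g = one G" if "g \<in> carrier G" for g
    using real[OF that] le[of "[]"] by (auto simp: ev_def)
  have quot: "inv\<^bsub>G\<^esub> (inv\<^bsub>G\<^esub> g \<otimes>\<^bsub>G\<^esub> h) = inv\<^bsub>G\<^esub> h \<otimes>\<^bsub>G\<^esub> g" if "g \<in> carrier G" "h \<in> carrier G" for g h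
    using that by (simp add: inv_mult_group)
  have comm_le: "word_dist G S h g \<le> word_dist G S g h" for g h
    using len_inv[of "inv\<^bsub>G\<^esub> g \<otimes>\<^bsub>G\<^esub> h"] quot[of g h] by (auto simp: word_dist_def)
  show ?thesis
  proof
    show "0 \<le> word_dist G S g h" for g h by (simp add: word_dist_def)
    show "word_dist G S g h = word_dist G S h g" for g h using comm_le by (simp add: antisym)
  next
    fix g h assume gh: "g \<in> carrier G" "h \<in> carrier G"
    have "inv\<^bsub>G\<^esub> g \<otimes>\<^bsub>G\<^esub> h = one G \<longleftrightarrow> g = h"
    proof
      assume "inv\<^bsub>G\<^esub> g \<otimes>\<^bsub>G\<^esub> h = one G"
      then have "inv\<^bsub>G\<^esub> g \<otimes>\<^bsub>G\<^esub> h = inv\<^bsub>G\<^esub> g \<otimes>\<^bsub>G\<^esub> g" using gh by simp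
      then show "g = h" using gh Units_l_cancel[of "inv\<^bsub>G\<^esub> g" h g] by simp
    qed (use gh in simp)
    then show "word_dist G S g h = 0 \<longleftrightarrow> g = h"
      using gh len_0[of "inv\<^bsub>G\<^esub> g \<otimes>\<^bsub>G\<^esub> h"] by (simp add: word_dist_def)
  next
    fix g h k assume ghk: "g \<in> carrier G" "h \<in> carrier G" "k \<in> carrier G"
    have "inv\<^bsub>G\<^esub> g \<otimes>\<^bsub>G\<^esub> k = (inv\<^bsub>G\<^esub> g \<otimes>\<^bsub>G\<^esub> h) \<otimes>\<^bsub>G\<^esub> (inv\<^bsub>G\<^esub> h \<otimes>\<^bsub>G\<^esub> k)"
      using ghk by (simp add: m_assoc) (simp add: m_assoc[symmetric])
    then show "word_dist G S g k \<le> word_dist G S g h + word_dist G S h k"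
      using ghk len_mult[of "inv\<^bsub>G\<^esub> g \<otimes>\<^bsub>G\<^esub> h" "inv\<^bsub>G\<^esub> h \<otimes>\<^bsub>G\<^esub> k"] by (simp add: word_dist_def)
  qed
qed

end

theory Submission
  imports Defs
begin

text \<open>
  The group \<open>nV\<close> has linear divergence: two elements at distance at most \<open>r\<close> and at least \<open>K * \<rho>\<close> from
  the identity are joined by a path of length at most \<open>A * r\<close> outside the ball of radius \<open>\<rho>\<close>
  (\<open>nV_linear_divergence\<close>). Rescaled, such paths converge to paths in an asymptotic cone that avoid
  the given point (\<open>no_cut_point\<close>).

  The elements of \<open>nV\<close> are the bijections that replace prefixes by prefixes near every point, with
  bounded lengths of the prefixes (\<open>carrier_nV\<close>). The bound is subadditive, so it is at most a
  constant \<open>C\<close> times the word length (\<open>depth_bound\<close>). This has two consequences. First, the change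
  of the prefix length at a point, a slope, is a lower bound for \<open>C\<close> times the word length. For a
  pump \<open>x\<close>, an element supported in a rectangle that fixes a corner of it and has slope one there,
  it follows that
  \<open>x\<^bsup>m\<^esup> v\<close> has length at least \<open>m / C\<close> whenever \<open>v\<close> is the identity on the rectangle (\<open>pump_bound\<close>).
  Second, an element \<open>g\<close> of length \<open>r\<close> maps every cell of depth greater than \<open>C * r\<close> into one half of the
  space (\<open>pump_into_half\<close>).

  Let \<open>M\<close> be a large multiple of \<open>r\<close>. If two pumps, or conjugates of them by elements of length \<open>O(r)\<close>,
  have disjoint supports, then their powers with exponent \<open>M\<close> can be exchanged along a path that stays
  far from the identity: multiply by the one, then remove the other (\<open>pump_switch\<close>). Starting at \<open>g\<close>,
  one goes to \<open>g z\<^bsup>M\<^esup>\<close>, where \<open>z\<close> is a fixed pump or its inverse; one of the two directions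
  avoids the ball (\<open>pump_ray_escapes\<close>). Exchanging leads to \<open>g x\<^bsup>M\<^esup>\<close> where \<open>x\<close> is a pump
  transported to a cell of depth \<open>O(r)\<close>, so small that \<open>g\<close> maps it into one half of the space. At this
  distance from the identity there is room to multiply by \<open>g\<^bsup>-1\<^esup>\<close>, and the result \<open>g x\<^bsup>M\<^esup> g\<^bsup>-1\<^esup>\<close> is the
  power of a map supported in this half. It can be exchanged for the power of a pump in the
  other half, which does not depend on \<open>g\<close> any more (\<open>reach_pump_power\<close>).
\<close>

section \<open>Germs of prefix replacements\<close>

lemma mem_cantor_power: "\<zeta> \<in> cantor_power n \<longleftrightarrow> \<zeta> \<in> extensional {..<n}"
  by (simp add: cantor_power_eq PiE_def)

lemma prefix_map_in: "prefix_map n w \<xi> \<in> cantor_power n"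
  by (simp add: mem_cantor_power prefix_map_def)

text \<open>Rectangles are described below by one of their points \<open>\<zeta>\<close> and a vector of depths \<open>a\<close>, not by
  words: \<open>graft n a \<zeta> \<xi>\<close> runs through the rectangle of depth \<open>a\<close> around \<open>\<zeta>\<close> when \<open>\<xi>\<close> varies. Two
  rectangles around the same point are then compared by comparing depths, which spares all
  comparisons of words.\<close>

definition graft ::
    "nat \<Rightarrow> (nat \<Rightarrow> nat) \<Rightarrow> (nat \<Rightarrow> bool word) \<Rightarrow> (nat \<Rightarrow> bool word) \<Rightarrow> (nat \<Rightarrow> bool word)" where
  "graft n a \<zeta> \<xi> = (\<lambda>i\<in>{..<n}. \<lambda>m. if m < a i then \<zeta> i m else \<xi> i (m - a i))"

definition tail :: "(nat \<Rightarrow> nat) \<Rightarrow> (nat \<Rightarrow> bool word) \<Rightarrow> (nat \<Rightarrow> bool word)" where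
  "tail a \<zeta> = (\<lambda>i m. \<zeta> i (a i + m))"

text \<open>Near \<open>\<zeta>\<close>, the map \<open>f\<close> replaces prefixes of lengths \<open>a\<close> by prefixes of lengths \<open>b\<close>; the words
  themselves are determined by \<open>\<zeta>\<close> and \<open>f \<zeta>\<close>.\<close>

definition shifts ::
    "nat \<Rightarrow> ((nat \<Rightarrow> bool word) \<Rightarrow> (nat \<Rightarrow> bool word)) \<Rightarrow> (nat \<Rightarrow> bool word) \<Rightarrow> (nat \<Rightarrow> nat) \<Rightarrow> (nat \<Rightarrow> nat) \<Rightarrow> bool"
  where "shifts n f \<zeta> a b \<longleftrightarrow> (\<forall>\<xi>. f (graft n a \<zeta> \<xi>) = graft n b (f \<zeta>) \<xi>)"

text \<open>The least such \<open>D\<close> behaves like a norm: it is subadditive for composition and finite on \<open>nV\<close>, hence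
  at most a constant times the word length. It bounds at the same time how deep a rectangle has to
  be in order to be moved by a prefix replacement, and how much depths can change.\<close>

definition bounded_shift :: "nat \<Rightarrow> nat \<Rightarrow> ((nat \<Rightarrow> bool word) \<Rightarrow> (nat \<Rightarrow> bool word)) \<Rightarrow> bool" where
  "bounded_shift n D f \<longleftrightarrow> (\<forall>\<zeta>\<in>cantor_power n. \<exists>a b. (\<forall>i<n. a i \<le> D \<and> b i \<le> D) \<and> shifts n f \<zeta> a b)"

lemma graft_in: "graft n a \<zeta> \<xi> \<in> cantor_power n"
  by (simp add: mem_cantor_power graft_def)

lemma graft_tail: "\<zeta> \<in> cantor_power n \<Longrightarrow> graft n a \<zeta> (tail a \<zeta>) = \<zeta>"
  by (auto simp: mem_cantor_power graft_def tail_def extensional_def fun_eq_iff)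

lemma graft_add: "graft n (\<lambda>i. a i + c i) \<zeta> \<xi> = graft n a \<zeta> (graft n c (tail a \<zeta>) \<xi>)"
  by (auto simp: graft_def tail_def fun_eq_iff restrict_def)

lemma graft_cong:
  assumes "\<And>i. i < n \<Longrightarrow> a i = b i" and "\<And>i m. i < n \<Longrightarrow> m < b i \<Longrightarrow> \<zeta> i m = \<eta> i m"
    and "\<And>i m. i < n \<Longrightarrow> \<xi> i m = \<xi>' i m"
  shows "graft n a \<zeta> \<xi> = graft n b \<eta> \<xi>'"
  using assms by (auto simp: graft_def fun_eq_iff restrict_def)

lemma graft_graft: "graft n a (graft n a \<zeta> \<xi>) \<xi>' = graft n a \<zeta> \<xi>'"
  by (auto simp: graft_def fun_eq_iff restrict_def)

lemma tail_graft: "i < n \<Longrightarrow> tail a (graft n a \<zeta> \<xi>) i = \<xi> i"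
  by (auto simp: graft_def tail_def)

lemma prefix_map_eq_graft:
  assumes "\<And>i. i < n \<Longrightarrow> prefix (length (w i)) (\<zeta> i) = w i"
  shows "prefix_map n w \<xi> = graft n (\<lambda>i. length (w i)) \<zeta> \<xi>"
proof -
  have "(w i \<frown> \<xi> i) m = (if m < length (w i) then \<zeta> i m else \<xi> i (m - length (w i)))" if "i < n" for i m
    using assms[OF that] by (metis (no_types, lifting) add.left_neutral conc_fst conc_snd diff_zero subsequence_nth)
  then show ?thesis by (auto simp: prefix_map_def graft_def fun_eq_iff restrict_def)
qed

lemma graft_eq_prefix_map: "graft n a \<zeta> \<xi> = prefix_map n (\<lambda>i. prefix (a i) (\<zeta> i)) \<xi>"
  by (subst prefix_map_eq_graft[where \<zeta> = \<zeta>]) simp_all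

lemma shifts_tail:
  assumes "shifts n f \<zeta> a b" "\<zeta> \<in> cantor_power n" "i < n"
  shows "tail b (f \<zeta>) i = tail a \<zeta> i"
proof -
  have "f \<zeta> = graft n b (f \<zeta>) (tail a \<zeta>)"
    using assms(1) graft_tail[OF assms(2), of a] unfolding shifts_def by metis
  then show ?thesis using tail_graft[OF assms(3)] by metis
qed

lemma shifts_add:
  assumes "shifts n f \<zeta> a b" "\<zeta> \<in> cantor_power n"
  shows "shifts n f \<zeta> (\<lambda>i. a i + c i) (\<lambda>i. b i + c i)"
  unfolding shifts_def
proof
  fix \<xi>
  have "f (graft n (\<lambda>i. a i + c i) \<zeta> \<xi>) = graft n b (f \<zeta>) (graft n c (tail a \<zeta>) \<xi>)"
    using assms(1) by (simp add: shifts_def graft_add)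
  also have "graft n c (tail a \<zeta>) \<xi> = graft n c (tail b (f \<zeta>)) \<xi>"
    using shifts_tail[OF assms] by (intro graft_cong) auto
  finally show "f (graft n (\<lambda>i. a i + c i) \<zeta> \<xi>) = graft n (\<lambda>i. b i + c i) (f \<zeta>) \<xi>"
    by (simp add: graft_add)
qed

lemma shifts_cong:
  assumes "shifts n f \<zeta> a b" and "\<And>i. i < n \<Longrightarrow> a i = a' i" "\<And>i. i < n \<Longrightarrow> b i = b' i"
  shows "shifts n f \<zeta> a' b'"
proof -
  have "graft n a' \<zeta> \<xi> = graft n a \<zeta> \<xi>" "graft n b' (f \<zeta>) \<xi> = graft n b (f \<zeta>) \<xi>" for \<xi>
    using assms by (auto intro!: graft_cong)
  then show ?thesis using assms(1) by (simp add: shifts_def)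
qed

lemma shifts_comp:
  assumes "shifts n g \<zeta> a b" "shifts n f (g \<zeta>) b c" "\<zeta> \<in> cantor_power n"
    and "\<And>x. x \<in> cantor_power n \<Longrightarrow> h x = f (g x)"
  shows "shifts n h \<zeta> a c"
  using assms by (simp add: shifts_def graft_in)

lemma shifts_inverse:
  assumes "shifts n f \<zeta> a b" "\<zeta> \<in> cantor_power n"
    and "\<And>x. x \<in> cantor_power n \<Longrightarrow> g (f x) = x"
  shows "shifts n g (f \<zeta>) b a"
  using assms by (metis shifts_def graft_in)

lemma shifts_same_cell:
  assumes "shifts n f \<zeta> a b"
  shows "shifts n f (graft n a \<zeta> \<xi>) a b"
  using assms by (simp add: shifts_def graft_graft)

text \<open>The difference \<open>b - a\<close> is a slope: it depends only on the germ of \<open>f\<close> at \<open>\<zeta>\<close>. Once the two sources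
  have been brought to the same depth, a longer target prefix would force a letter of the free tail.\<close>

lemma shifts_unique:
  assumes f: "shifts n f \<zeta> a b" "shifts n f \<zeta> a' b'" and \<zeta>: "\<zeta> \<in> cantor_power n" and i: "i < n"
  shows "b i + a' i = b' i + a i"
proof -
  have aux: "b i \<le> b' i" if s: "shifts n f \<zeta> a b" "shifts n f \<zeta> a b'" for a b b'
  proof (rule ccontr)
    assume "\<not> b i \<le> b' i"
    then have lt: "b' i < b i" by simp
    let ?\<xi> = "\<lambda>_ _. \<not> f \<zeta> i (b' i)"
    have "graft n b (f \<zeta>) ?\<xi> i (b' i) = graft n b' (f \<zeta>) ?\<xi> i (b' i)"
      using s by (metis shifts_def)
    then show False using i lt by (simp add: graft_def)
  qed
  have 1: "shifts n f \<zeta> (\<lambda>i. a i + a' i) (\<lambda>i. b i + a' i)"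
    using shifts_add[OF f(1) \<zeta>] .
  have 2: "shifts n f \<zeta> (\<lambda>i. a i + a' i) (\<lambda>i. b' i + a i)"
    using shifts_add[OF f(2) \<zeta>, of a] by (rule shifts_cong) auto
  show ?thesis using aux[OF 1 2] aux[OF 2 1] by simp
qed

lemma shifts_raise_source:
  assumes "shifts n f \<zeta> a b" "\<zeta> \<in> cantor_power n" "\<And>i. i < n \<Longrightarrow> a i \<le> c i"
  shows "shifts n f \<zeta> c (\<lambda>i. b i + (c i - a i))"
  using shifts_add[OF assms(1,2), of "\<lambda>i. c i - a i"] by (rule shifts_cong) (use assms(3) in auto)

lemma shifts_raise_target:
  assumes "shifts n f \<zeta> a b" "\<zeta> \<in> cantor_power n" "\<And>i. i < n \<Longrightarrow> b i \<le> c i"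
  shows "shifts n f \<zeta> (\<lambda>i. a i + (c i - b i)) c"
  using shifts_add[OF assms(1,2), of "\<lambda>i. c i - b i"] by (rule shifts_cong) (use assms(3) in auto)

lemma bounded_shift_comp:
  assumes f: "bounded_shift n D f" and g: "bounded_shift n E g"
    and maps: "\<And>x. x \<in> cantor_power n \<Longrightarrow> g x \<in> cantor_power n"
    and h: "\<And>x. x \<in> cantor_power n \<Longrightarrow> h x = f (g x)"
  shows "bounded_shift n (E + D) h"
  unfolding bounded_shift_def
proof
  fix \<zeta> assume \<zeta>: "\<zeta> \<in> cantor_power n"
  obtain a b where ab: "\<forall>i<n. a i \<le> E \<and> b i \<le> E" "shifts n g \<zeta> a b"
    using g \<zeta> unfolding bounded_shift_def by blast
  obtain a' b' where ab': "\<forall>i<n. a' i \<le> D \<and> b' i \<le> D" "shifts n f (g \<zeta>) a' b'"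
    using f maps[OF \<zeta>] unfolding bounded_shift_def by blast
  let ?c = "\<lambda>i. max (b i) (a' i)"
  have "shifts n h \<zeta> (\<lambda>i. a i + (?c i - b i)) (\<lambda>i. b' i + (?c i - a' i))"
    by (rule shifts_comp[OF shifts_raise_target[OF ab(2) \<zeta>]
          shifts_raise_source[OF ab'(2) maps[OF \<zeta>]] \<zeta> h]) auto
  moreover have "a i + (?c i - b i) \<le> E + D \<and> b' i + (?c i - a' i) \<le> E + D" if "i < n" for i
    using ab(1) ab'(1) that by (auto simp: max_def dest!: spec[where x=i])
  ultimately show "\<exists>a b. (\<forall>i<n. a i \<le> E + D \<and> b i \<le> E + D) \<and> shifts n h \<zeta> a b"
    by (intro exI[of _ "\<lambda>i. a i + (?c i - b i)"] exI[of _ "\<lambda>i. b' i + (?c i - a' i)"]) simp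
qed

lemma bounded_shift_inverse:
  assumes f: "bounded_shift n D f"
    and maps: "\<And>x. x \<in> cantor_power n \<Longrightarrow> g x \<in> cantor_power n"
    and gf: "\<And>x. x \<in> cantor_power n \<Longrightarrow> g (f x) = x"
    and fg: "\<And>x. x \<in> cantor_power n \<Longrightarrow> f (g x) = x"
  shows "bounded_shift n D g"
  unfolding bounded_shift_def
proof
  fix \<zeta> assume \<zeta>: "\<zeta> \<in> cantor_power n"
  obtain a b where ab: "\<forall>i<n. a i \<le> D \<and> b i \<le> D" "shifts n f (g \<zeta>) a b"
    using f maps[OF \<zeta>] unfolding bounded_shift_def by blast
  have "shifts n g \<zeta> b a"
    using shifts_inverse[OF ab(2) maps[OF \<zeta>], of g] gf fg \<zeta> by simp
  then show "\<exists>a b. (\<forall>i<n. a i \<le> D \<and> b i \<le> D) \<and> shifts n g \<zeta> a b"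
    using ab(1) by blast
qed

lemma bounded_shift_mono: "bounded_shift n D f \<Longrightarrow> D \<le> E \<Longrightarrow> bounded_shift n E f"
  unfolding bounded_shift_def by (meson order_trans)

section \<open>Rectangles and patterns\<close>

lemma mem_rectangle:
  "\<zeta> \<in> rectangle n w \<longleftrightarrow> \<zeta> \<in> cantor_power n \<and> (\<forall>i<n. prefix (length (w i)) (\<zeta> i) = w i)"
proof
  assume "\<zeta> \<in> rectangle n w"
  then obtain \<xi> where "\<zeta> = prefix_map n w \<xi>" by (auto simp: rectangle_def)
  then show "\<zeta> \<in> cantor_power n \<and> (\<forall>i<n. prefix (length (w i)) (\<zeta> i) = w i)"
    using prefix_map_in by (auto simp: prefix_map_def)
next
  assume a: "\<zeta> \<in> cantor_power n \<and> (\<forall>i<n. prefix (length (w i)) (\<zeta> i) = w i)"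
  let ?a = "\<lambda>i. length (w i)"
  have "\<zeta> = graft n ?a \<zeta> (tail ?a \<zeta>)" using a graft_tail by metis
  also have "\<dots> = graft n ?a \<zeta> (restrict (tail ?a \<zeta>) {..<n})" by (rule graft_cong) auto
  also have "\<dots> = prefix_map n w (restrict (tail ?a \<zeta>) {..<n})"
    using a by (subst prefix_map_eq_graft[where \<zeta> = \<zeta>]) auto
  finally show "\<zeta> \<in> rectangle n w"
    unfolding rectangle_def by (metis imageI mem_cantor_power restrict_extensional)
qed

lemma prefix_map_in_rectangle: "prefix_map n w \<xi> \<in> rectangle n w"
  unfolding mem_rectangle using prefix_map_in by (auto simp: prefix_map_def)

lemma rectangle_nonempty: "rectangle n w \<noteq> {}"
  using prefix_map_in_rectangle by blast

lemma rectangle_trivial: "rectangle n (\<lambda>_. []) = cantor_power n"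
  by (auto simp: mem_rectangle)

lemma mem_rectangle_append:
  assumes i: "i < n"
  shows "\<zeta> \<in> rectangle n (w(i := w i @ [x])) \<longleftrightarrow> \<zeta> \<in> rectangle n w \<and> \<zeta> i (length (w i)) = x"
proof
  assume l: "\<zeta> \<in> rectangle n (w(i := w i @ [x]))"
  have "prefix (Suc (length (w i))) (\<zeta> i) = w i @ [x]"
    using l i unfolding mem_rectangle by (metis fun_upd_same length_append_singleton)
  moreover have "prefix (length (w j)) (\<zeta> j) = w j" if "j < n" "j \<noteq> i" for j
    using l that unfolding mem_rectangle by (metis fun_upd_other)
  ultimately show "\<zeta> \<in> rectangle n w \<and> \<zeta> i (length (w i)) = x"
    using l unfolding mem_rectangle by auto
next
  assume "\<zeta> \<in> rectangle n w \<and> \<zeta> i (length (w i)) = x"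
  then show "\<zeta> \<in> rectangle n (w(i := w i @ [x]))" unfolding mem_rectangle by simp
qed

lemma rectangle_split:
  assumes "i < n"
  shows "rectangle n w = rectangle n (w(i := w i @ [False])) \<union> rectangle n (w(i := w i @ [True]))"
    and "rectangle n (w(i := w i @ [False])) \<inter> rectangle n (w(i := w i @ [True])) = {}"
  using mem_rectangle_append[OF assms] by auto

lemma pattern_Union: "pattern n P \<Longrightarrow> \<Union>P = cantor_power n"
proof (induction rule: pattern.induct)
  case (subdivide P w i)
  have "\<Union>P = \<Union>(P - {rectangle n w}) \<union> rectangle n w" using subdivide.hyps(2) by blast
  then show ?case
    using subdivide.IH rectangle_split(1)[OF subdivide.hyps(3), of w] by (simp only: Union_Un_distrib Union_insert Union_empty Un_empty_right)
qed simp

lemma pattern_disjoint: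
  "pattern n P \<Longrightarrow> R \<in> P \<Longrightarrow> R' \<in> P \<Longrightarrow> R \<noteq> R' \<Longrightarrow> R \<inter> R' = {}"
proof (induction arbitrary: R R' rule: pattern.induct)
  case (subdivide P w i)
  note s = rectangle_split[OF subdivide.hyps(3), of w]
  have IH: "A \<inter> B = {}" if "A \<in> P" "B \<in> P" "A \<noteq> B" for A B using subdivide.IH that by blast
  let ?R = "rectangle n w"
  let ?H = "{rectangle n (w(i := w i @ [False])), rectangle n (w(i := w i @ [True]))}"
  have sub: "B \<subseteq> ?R" if "B \<in> ?H" for B
    using that s(1) by (elim insertE) simp_all
  have old_new: "A \<inter> B = {}" if A: "A \<in> P - {?R}" and B: "B \<in> ?H" for A B
  proof -
    have "A \<inter> ?R = {}" using A subdivide.hyps(2) by (intro IH) simp_all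
    then show ?thesis using sub[OF B] by blast
  qed
  have new_new: "A \<inter> B = {}" if A: "A \<in> ?H" "B \<in> ?H" "A \<noteq> B" for A B
    using A s(2) by (elim insertE) (simp_all add: Int_commute)
  show ?case using subdivide.prems(1,2)
  proof (elim UnE)
    assume "R \<in> P - {?R}" "R' \<in> P - {?R}"
    then show ?thesis using IH subdivide.prems(3) by simp
  next
    assume "R \<in> P - {?R}" "R' \<in> ?H"
    then show ?thesis by (rule old_new)
  next
    assume "R \<in> ?H" "R' \<in> P - {?R}"
    then show ?thesis using old_new by (subst Int_commute)
  next
    assume "R \<in> ?H" "R' \<in> ?H"
    then show ?thesis using subdivide.prems(3) by (rule new_new)
  qed
qed auto

lemma nV_bounded_shift:
  assumes "f \<in> carrier (nV n)"
  shows "\<exists>D. bounded_shift n D f"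
proof -
  obtain m w u where w: "numbered_pattern n m w"
    and f: "\<forall>j<m. \<forall>\<zeta>\<in>cantor_power n. f (prefix_map n (w j) \<zeta>) = prefix_map n (u j) \<zeta>"
    using assms by (auto simp: nV_def)
  obtain P where P: "pattern n P" "bij_betw (\<lambda>j. rectangle n (w j)) {..<m} P"
    using w unfolding numbered_pattern_def by blast
  define D where "D = (\<Sum>j<m. \<Sum>i<n. length (w j i) + length (u j i))"
  have D: "length (w j i) + length (u j i) \<le> D" if "j < m" "i < n" for j i
  proof -
    have "length (w j i) + length (u j i) \<le> (\<Sum>i<n. length (w j i) + length (u j i))"
      by (rule member_le_sum) (use that in auto)
    also have "\<dots> \<le> D" unfolding D_def by (rule member_le_sum) (use that in auto)
    finally show ?thesis .
  qed
  have "\<exists>a b. (\<forall>i<n. a i \<le> D \<and> b i \<le> D) \<and> shifts n f \<zeta> a b" if \<zeta>: "\<zeta> \<in> cantor_power n" for \<zeta>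
  proof -
    have "\<Union>P = (\<Union>j<m. rectangle n (w j))" using bij_betw_imp_surj_on[OF P(2)] by auto
    then obtain j where j: "j < m" "\<zeta> \<in> rectangle n (w j)" using pattern_Union[OF P(1)] \<zeta> by auto
    have fj: "f (prefix_map n (w j) \<xi>) = prefix_map n (u j) \<xi>" for \<xi>
    proof -
      have "prefix_map n v \<xi> = prefix_map n v (restrict \<xi> {..<n})" for v
        by (auto simp: prefix_map_def fun_eq_iff)
      then show ?thesis using f j(1) by (metis mem_cantor_power restrict_extensional)
    qed
    have "f \<zeta> \<in> rectangle n (u j)"
      using j(2) fj prefix_map_in_rectangle by (force simp: rectangle_def)
    then have "prefix_map n (w j) \<xi> = graft n (\<lambda>i. length (w j i)) \<zeta> \<xi>"
        "prefix_map n (u j) \<xi> = graft n (\<lambda>i. length (u j i)) (f \<zeta>) \<xi>" for \<xi>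
      using j(2) by (auto simp: mem_rectangle intro!: prefix_map_eq_graft)
    then have "shifts n f \<zeta> (\<lambda>i. length (w j i)) (\<lambda>i. length (u j i))"
      using fj by (simp add: shifts_def)
    moreover have "\<forall>i<n. length (w j i) \<le> D \<and> length (u j i) \<le> D" using D[OF j(1)] by fastforce
    ultimately show ?thesis by (intro exI[of _ "\<lambda>i. length (w j i)"] exI[of _ "\<lambda>i. length (u j i)"]) simp
  qed
  then show ?thesis unfolding bounded_shift_def by blast
qed

text \<open>The sets of rectangles obtained by subdividing a single rectangle, following a binary tree. Working
  inside one rectangle at a time makes it possible to subdivide the rectangles of a pattern
  independently of each other.\<close>

inductive refines :: "nat \<Rightarrow> (nat \<Rightarrow> bool list) \<Rightarrow> (nat \<Rightarrow> bool word) set set \<Rightarrow> bool" for n where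
  whole: "refines n w {rectangle n w}"
| split: "\<lbrakk>i < n; refines n (w(i := w i @ [False])) Q; refines n (w(i := w i @ [True])) Q'\<rbrakk>
    \<Longrightarrow> refines n w (Q \<union> Q')"

lemma refines_parts:
  "refines n w Q \<Longrightarrow> R \<in> Q \<Longrightarrow> R \<subseteq> rectangle n w \<and> R \<noteq> {}"
proof (induction rule: refines.induct)
  case (split i w Q Q')
  note s = rectangle_split(1)[OF split.hyps(1), of w]
  from split.prems show ?case
  proof (elim UnE)
    assume "R \<in> Q"
    then have "R \<subseteq> rectangle n (w(i := w i @ [False])) \<and> R \<noteq> {}" by (rule split.IH)
    then show ?case unfolding s by (simp add: le_supI1)
  next
    assume "R \<in> Q'"
    then have "R \<subseteq> rectangle n (w(i := w i @ [True])) \<and> R \<noteq> {}" by (rule split.IH)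
    then show ?case unfolding s by (simp add: le_supI2)
  qed
qed (simp add: rectangle_nonempty)

text \<open>Subdivisions of one rectangle do not interfere with the others because a pattern is disjoint and
  its rectangles are nonempty; this is what makes the set differences in the definition of patterns
  harmless.\<close>

lemma pattern_refines:
  "refines n w Q \<Longrightarrow> pattern n P \<Longrightarrow> rectangle n w \<in> P \<Longrightarrow> pattern n (P - {rectangle n w} \<union> Q)"
proof (induction arbitrary: P rule: refines.induct)
  case (whole w)
  then show ?case by (simp add: insert_absorb)
next
  case (split i w Q Q')
  let ?R = "rectangle n w" and ?RF = "rectangle n (w(i := w i @ [False]))"
    and ?RT = "rectangle n (w(i := w i @ [True]))"
  note s = rectangle_split[OF split.hyps(1), of w]
  have ne: "?RF \<noteq> {}" "?RT \<noteq> {}" by (simp_all add: rectangle_nonempty)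
  have notin: "A \<notin> P - {?R}" if "A \<subseteq> ?R" "A \<noteq> {}" for A
  proof
    assume "A \<in> P - {?R}"
    then have "A \<inter> ?R = {}" by (metis DiffE pattern_disjoint[OF split.prems(1) _ split.prems(2)] singletonI)
    then show False using that by blast
  qed
  let ?PF = "P - {?R} \<union> {?RF, ?RT}"
  have P1: "pattern n ?PF" by (rule pattern.subdivide[OF split.prems split.hyps(1)])
  let ?PT = "?PF - {?RF} \<union> Q"
  have P2: "pattern n ?PT" by (rule split.IH(1)[OF P1], rule UnI2, rule insertI1)
  have "?RT \<in> ?PT" using s(2) ne by auto
  from split.IH(2)[OF P2 this] have P3: "pattern n (?PT - {?RT} \<union> Q')" .
  have R0: "?RF \<notin> P - {?R}" and R1: "?RT \<notin> P - {?R}" using notin s(1) ne by simp_all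
  have R1': "?RT \<notin> Q" using refines_parts[OF split.hyps(2), of ?RT] s(2) ne(2) by blast
  have "A \<union> {B, C} - {B} \<union> D - {C} \<union> E = A \<union> (D \<union> E)"
    if "B \<notin> A" "C \<notin> A" "C \<notin> D" for A D E :: "'a set" and B C
    using that by auto
  from this[OF R0 R1 R1'] have "?PT - {?RT} \<union> Q' = P - {?R} \<union> (Q \<union> Q')" .
  then show ?case using P3 by simp
qed

definition extensions :: "nat \<Rightarrow> (nat \<Rightarrow> bool list) \<Rightarrow> (nat \<Rightarrow> nat) \<Rightarrow> (nat \<Rightarrow> bool list) set" where
  "extensions n w k = {w'. (\<forall>i<n. \<exists>v. w' i = w i @ v \<and> length v = k i) \<and> (\<forall>i\<ge>n. w' i = w i)}"

lemma extensions_split: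
  assumes i: "i < n" and k: "k i = Suc l"
  shows "extensions n w k = extensions n (w(i := w i @ [False])) (k(i := l)) \<union>
    extensions n (w(i := w i @ [True])) (k(i := l))" (is "_ = ?A \<union> ?B")
proof (intro equalityI subsetI)
  fix w' assume w': "w' \<in> extensions n w k"
  then obtain v where v: "w' i = w i @ v" "length v = Suc l" using i k by (auto simp: extensions_def)
  then obtain x v' where "v = x # v'" "length v' = l" by (cases v) auto
  then show "w' \<in> ?A \<union> ?B" using w' v(1) i by (cases x) (auto simp: extensions_def)
next
  fix w' assume "w' \<in> ?A \<union> ?B"
  then show "w' \<in> extensions n w k"
  proof
    assume w': "w' \<in> ?A"
    then obtain v where "w' i = w i @ [False] @ v" "length v = l" using i by (auto simp: extensions_def)
    then have "\<exists>v. w' i = w i @ v \<and> length v = k i" using k by (intro exI[of _ "[False] @ v"]) simp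
    then show ?thesis using w' i by (auto simp: extensions_def split: if_splits)
  next
    assume w': "w' \<in> ?B"
    then obtain v where "w' i = w i @ [True] @ v" "length v = l" using i by (auto simp: extensions_def)
    then have "\<exists>v. w' i = w i @ v \<and> length v = k i" using k by (intro exI[of _ "[True] @ v"]) simp
    then show ?thesis using w' i by (auto simp: extensions_def split: if_splits)
  qed
qed

text \<open>The subdivisions \<open>Q w'\<close> are arbitrary so that the lemma can be applied to its own results: after a
  rectangle has been cut into cells of a prescribed depth, each cell can be cut further by an amount
  that depends on it.\<close>

lemma refines_extensions:
  assumes "\<And>w'. w' \<in> extensions n w k \<Longrightarrow> refines n w' (Q w')"
  shows "refines n w (\<Union>w'\<in>extensions n w k. Q w')"
  using assms
proof (induction "\<Sum>i<n. k i" arbitrary: w k)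
  case 0
  have "w' = w" if w': "w' \<in> extensions n w k" for w'
  proof
    show "w' i = w i" for i using w' 0(1) by (cases "i < n") (auto simp: extensions_def)
  qed
  moreover have "w \<in> extensions n w k" using 0(1) by (auto simp: extensions_def)
  ultimately have "extensions n w k = {w}" by blast
  then show ?case using 0 by simp
next
  case (Suc s)
  then obtain i where i: "i < n" "k i \<noteq> 0" by (metis lessThan_iff nat.distinct(1) sum.neutral)
  then obtain l where l: "k i = Suc l" using not0_implies_Suc by blast
  have "(\<Sum>j<n. k j) = k i + (\<Sum>j\<in>{..<n} - {i}. k j)"
    using i by (simp add: sum.remove)
  moreover have "(\<Sum>j<n. (k(i := l)) j) = l + (\<Sum>j\<in>{..<n} - {i}. k j)"
    using i by (subst sum.remove[of _ i]) (auto intro!: sum.cong)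
  ultimately have s: "s = (\<Sum>j<n. (k(i := l)) j)" using Suc.hyps(2) l by simp
  have ex: "extensions n w k = extensions n (w(i := w i @ [False])) (k(i := l)) \<union>
      extensions n (w(i := w i @ [True])) (k(i := l))"
    by (rule extensions_split[where k = k, OF i(1) l])
  have "refines n w ((\<Union>w'\<in>extensions n (w(i := w i @ [False])) (k(i := l)). Q w') \<union>
     (\<Union>w'\<in>extensions n (w(i := w i @ [True])) (k(i := l)). Q w'))"
  proof (rule refines.split[OF i(1)]; rule Suc.hyps(1)[OF s]; rule Suc.prems)
    show "w' \<in> extensions n w k" if "w' \<in> extensions n (w(i := w i @ [False])) (k(i := l))" for w'
      using that ex by blast
    show "w' \<in> extensions n w k" if "w' \<in> extensions n (w(i := w i @ [True])) (k(i := l))" for w'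
      using that ex by blast
  qed
  then show ?case unfolding ex by (simp only: UN_Un)
qed

section \<open>The group nV in terms of depths\<close>

lemma rectangle_inject:
  assumes "rectangle n w = rectangle n w'" "\<And>i. i < n \<Longrightarrow> length (w i) = length (w' i)" "i < n"
  shows "w i = w' i"
  using assms prefix_map_in_rectangle[of n w undefined] by (metis mem_rectangle)

lemma finite_extensions: "finite (extensions n (\<lambda>_. []) k)"
proof -
  have "finite (\<Union>i<n. {v :: bool list. length v = k i})"
    using finite_lists_length_eq[of "UNIV :: bool set"] by auto
  then have "finite {f. \<forall>i. (i \<in> {..<n} \<longrightarrow> f i \<in> (\<Union>i<n. {v :: bool list. length v = k i})) \<and> (i \<notin> {..<n} \<longrightarrow> f i = [])}"
    by (rule finite_set_of_finite_funs[OF finite_lessThan])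
  then show ?thesis by (rule rev_finite_subset) (auto simp: extensions_def)
qed

lemma extensions_prefix:
  assumes "\<And>i. i < n \<Longrightarrow> b i = a i + k i"
  shows "(\<lambda>i. if i < n then prefix (b i) (\<zeta> i) else []) \<in> extensions n (\<lambda>i. if i < n then prefix (a i) (\<zeta> i) else []) k"
  using assms by (auto simp: extensions_def subsequence_append)

text \<open>A partition into rectangles need not be a pattern in dimension at least three, so the pattern on the
  source has to be produced by subdivision. All cells of depth \<open>D\<close> are mapped by prefix replacements,
  to rectangles of depth at most \<open>2 * D\<close>. Cutting each of them by the amount missing in its image
  gives a pattern whose rectangles are mapped exactly onto the cells of depth \<open>2 * D\<close>.\<close>

lemma bounded_shift_numbered:
  assumes f: "f \<in> Bij (cantor_power n)" and D: "bounded_shift n D f"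
  shows "\<exists>m w u. numbered_pattern n m w \<and> numbered_pattern n m u \<and>
    (\<forall>j<m. \<forall>\<zeta>\<in>cantor_power n. f (prefix_map n (w j) \<zeta>) = prefix_map n (u j) \<zeta>)"
proof -
  let ?X = "cantor_power n"
  define E where "E = extensions n (\<lambda>_. [])"
  define pt where "pt c = prefix_map n c (\<lambda>_ _. False)" for c
  have inj: "inj_on f ?X" and surj: "f ` ?X = ?X" using f by (auto simp: Bij_def bij_betw_def)
  have "\<forall>c. \<exists>b. (\<forall>i<n. b i \<le> 2 * D) \<and> shifts n f (pt c) (\<lambda>_. D) b"
  proof
    fix c
    have "pt c \<in> ?X" by (simp add: pt_def prefix_map_in)
    then obtain a b where ab: "\<forall>i<n. a i \<le> D \<and> b i \<le> D" "shifts n f (pt c) a b"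
      using D unfolding bounded_shift_def by blast
    have "shifts n f (pt c) (\<lambda>_. D) (\<lambda>i. b i + (D - a i))"
      by (rule shifts_raise_source[OF ab(2) \<open>pt c \<in> ?X\<close>]) (use ab in simp)
    moreover have "\<forall>i<n. b i + (D - a i) \<le> 2 * D" using ab(1) by fastforce
    ultimately show "\<exists>b. (\<forall>i<n. b i \<le> 2 * D) \<and> shifts n f (pt c) (\<lambda>_. D) b"
      by (intro exI[of _ "\<lambda>i. b i + (D - a i)"] conjI)
  qed
  from choice[OF this] obtain b where
    b: "\<And>c i. i < n \<Longrightarrow> b c i \<le> 2 * D" "\<And>c. shifts n f (pt c) (\<lambda>_. D) (b c)" by blast
  define Q where "Q c = (\<Union>c'\<in>extensions n c (\<lambda>i. 2 * D - b c i). {rectangle n c'})" for c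
  define P where "P = (\<Union>c\<in>E (\<lambda>_. D). Q c)"
  define P' where "P' = (\<Union>u\<in>E (\<lambda>_. 2 * D). {rectangle n u})"
  have "refines n (\<lambda>_. []) P" unfolding P_def E_def Q_def
    by (intro refines_extensions refines.whole)
  then have P: "pattern n P"
    using pattern_refines[OF _ pattern.trivial, of n "\<lambda>_. []" P] by (simp add: rectangle_trivial)
  have "refines n (\<lambda>_. []) P'" unfolding P'_def E_def
    by (intro refines_extensions refines.whole)
  then have P': "pattern n P'"
    using pattern_refines[OF _ pattern.trivial, of n "\<lambda>_. []" P'] by (simp add: rectangle_trivial)
  \<comment> \<open>The cells of \<open>P\<close> are the preimages of the cells of depth \<open>2 * D\<close>.\<close>
  have shift: "shifts n f \<zeta> (\<lambda>i. D + (2 * D - b c i)) (\<lambda>_. 2 * D)"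
    if \<zeta>: "\<zeta> \<in> rectangle n c" and c: "c \<in> E (\<lambda>_. D)" for \<zeta> c
  proof -
    have len: "length (c i) = D" if "i < n" for i using c that by (auto simp: E_def extensions_def)
    have \<zeta>X: "\<zeta> \<in> ?X" using \<zeta> by (simp add: mem_rectangle)
    have pc: "prefix D (pt c i) = c i" if "i < n" for i
      using prefix_map_in_rectangle[of n c "\<lambda>_ _. False"] len that by (auto simp: mem_rectangle pt_def)
    have "graft n (\<lambda>_. D) (pt c) (tail (\<lambda>_. D) \<zeta>) = graft n (\<lambda>_. D) \<zeta> (tail (\<lambda>_. D) \<zeta>)"
      using \<zeta> len pc by (simp add: graft_eq_prefix_map mem_rectangle) (auto simp: prefix_map_def fun_eq_iff)
    then have eq: "graft n (\<lambda>_. D) (pt c) (tail (\<lambda>_. D) \<zeta>) = \<zeta>" using graft_tail[OF \<zeta>X] by simp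
    have "shifts n f \<zeta> (\<lambda>_. D) (b c)"
      using shifts_same_cell[OF b(2)[of c], of "tail (\<lambda>_. D) \<zeta>"] by (simp add: eq)
    from shifts_raise_target[OF this \<zeta>X, of "\<lambda>_. 2 * D"] show ?thesis using b(1) by simp
  qed
  have cell: "f (prefix_map n w \<xi>) = prefix_map n u \<xi>"
    if "shifts n f \<zeta> a d" "w = (\<lambda>i. if i < n then prefix (a i) (\<zeta> i) else [])"
      "u = (\<lambda>i. if i < n then prefix (d i) (f \<zeta> i) else [])" for \<zeta> a d w u \<xi>
  proof -
    have "prefix_map n w \<xi> = graft n a \<zeta> \<xi>" "prefix_map n u \<xi> = graft n d (f \<zeta>) \<xi>"
      using that(2,3) by (simp_all add: graft_eq_prefix_map) (simp_all add: prefix_map_def fun_eq_iff)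
    then show ?thesis using that(1) by (simp add: shifts_def)
  qed
  have "\<forall>u\<in>E (\<lambda>_. 2 * D). \<exists>w. rectangle n w \<in> P \<and> (\<forall>\<xi>. f (prefix_map n w \<xi>) = prefix_map n u \<xi>)"
  proof
    fix u assume u: "u \<in> E (\<lambda>_. 2 * D)"
    have "pt u \<in> ?X" by (simp add: pt_def prefix_map_in)
    then obtain \<zeta> where \<zeta>: "\<zeta> \<in> ?X" "f \<zeta> = pt u" using surj by (metis imageE)
    define c where "c = (\<lambda>i. if i < n then prefix D (\<zeta> i) else [])"
    have c: "c \<in> E (\<lambda>_. D)" unfolding E_def extensions_def c_def by auto
    have "\<zeta> \<in> rectangle n c" using \<zeta> by (simp add: mem_rectangle c_def)
    note s = shift[OF this c]
    define w where "w = (\<lambda>i. if i < n then prefix (D + (2 * D - b c i)) (\<zeta> i) else [])"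
    have w: "w \<in> extensions n c (\<lambda>i. 2 * D - b c i)"
      unfolding w_def by (subst (2) c_def) (rule extensions_prefix, simp)
    have "u = (\<lambda>i. if i < n then prefix (2 * D) (f \<zeta> i) else [])"
    proof
      show "u i = (if i < n then prefix (2 * D) (f \<zeta> i) else [])" for i
        using u prefix_map_in_rectangle[of n u "\<lambda>_ _. False"]
        by (simp add: \<zeta>(2) E_def extensions_def mem_rectangle pt_def)
    qed
    from cell[OF s w_def this] show "\<exists>w. rectangle n w \<in> P \<and> (\<forall>\<xi>. f (prefix_map n w \<xi>) = prefix_map n u \<xi>)"
      using w c by (auto simp: P_def Q_def)
  qed
  from bchoice[OF this] obtain w where w: "\<And>u. u \<in> E (\<lambda>_. 2 * D) \<Longrightarrow> rectangle n (w u) \<in> P"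
    "\<And>u \<xi>. u \<in> E (\<lambda>_. 2 * D) \<Longrightarrow> f (prefix_map n (w u) \<xi>) = prefix_map n u \<xi>" by blast
  have image: "f ` rectangle n v = rectangle n u" if "\<And>\<xi>. f (prefix_map n v \<xi>) = prefix_map n u \<xi>" for v u
    using that by (simp add: rectangle_def image_image)
  have ex: "\<exists>u\<in>E (\<lambda>_. 2 * D). f ` R = rectangle n u" if R: "R \<in> P" for R
  proof -
    obtain c c' where c: "c \<in> E (\<lambda>_. D)" and c': "c' \<in> extensions n c (\<lambda>i. 2 * D - b c i)"
      and R: "R = rectangle n c'" using R by (auto simp: P_def Q_def)
    have len: "length (c i) = D" if "i < n" for i using c that by (auto simp: E_def extensions_def)
    have len': "length (c' i) = D + (2 * D - b c i)" if "i < n" for i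
      using c' len that by (auto simp: extensions_def)
    have e: "c' i = []" if "\<not> i < n" for i using that c c' by (auto simp: extensions_def E_def)
    have m: "pt c' \<in> rectangle n c'" by (simp add: pt_def prefix_map_in_rectangle)
    have "pt c' \<in> rectangle n c" unfolding mem_rectangle
    proof (intro conjI allI impI)
      show "pt c' \<in> ?X" by (simp add: pt_def prefix_map_in)
      fix i assume i: "i < n"
      then obtain v where "c' i = c i @ v" using c' by (auto simp: extensions_def)
      then show "prefix (length (c i)) (pt c' i) = c i" using i by (simp add: pt_def prefix_map_def)
    qed
    note s = shift[OF this c]
    have c'_eq: "c' = (\<lambda>i. if i < n then prefix (D + (2 * D - b c i)) (pt c' i) else [])"
      using m len' e by (auto simp: mem_rectangle fun_eq_iff)
    let ?u = "\<lambda>i. if i < n then prefix (2 * D) (f (pt c') i) else []"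
    have "f ` R = rectangle n ?u" unfolding R by (rule image) (rule cell[OF s c'_eq refl])
    moreover have "?u \<in> E (\<lambda>_. 2 * D)" by (auto simp: E_def extensions_def)
    ultimately show ?thesis by blast
  qed
  have inj_rect: "inj_on (rectangle n) (E (\<lambda>_. 2 * D))"
  proof (rule inj_onI)
    fix u v assume uv: "u \<in> E (\<lambda>_. 2 * D)" "v \<in> E (\<lambda>_. 2 * D)" "rectangle n u = rectangle n v"
    show "u = v"
    proof
      fix i
      show "u i = v i"
      proof (cases "i < n")
        case True
        then show ?thesis using uv by (intro rectangle_inject[of n u v]) (auto simp: E_def extensions_def)
      qed (use uv in \<open>auto simp: E_def extensions_def\<close>)
    qed
  qed
  have bij': "bij_betw (rectangle n) (E (\<lambda>_. 2 * D)) P'"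
    using inj_rect by (auto simp: bij_betw_def P'_def)
  have sub: "R \<subseteq> ?X" if "R \<in> P" for R using pattern_Union[OF P] that by blast
  have bij: "bij_betw (\<lambda>u. rectangle n (w u)) (E (\<lambda>_. 2 * D)) P"
    unfolding bij_betw_def
  proof (intro conjI inj_onI equalityI subsetI)
    fix u v assume uv: "u \<in> E (\<lambda>_. 2 * D)" "v \<in> E (\<lambda>_. 2 * D)" "rectangle n (w u) = rectangle n (w v)"
    then have "rectangle n u = rectangle n v" using image w(2) by metis
    then show "u = v" using inj_rect uv by (simp add: inj_on_def)
  next
    fix R assume R: "R \<in> P"
    then obtain u where u: "u \<in> E (\<lambda>_. 2 * D)" "f ` R = rectangle n u" using ex by blast
    then have "f ` R = f ` rectangle n (w u)" using image w(2) by metis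
    then have "R = rectangle n (w u)" using inj_on_image_eq_iff[OF inj] sub R w(1) u(1) by metis
    then show "R \<in> (\<lambda>u. rectangle n (w u)) ` E (\<lambda>_. 2 * D)" using u by blast
  qed (use w in auto)
  obtain h where h: "bij_betw h {0..<card (E (\<lambda>_. 2 * D))} (E (\<lambda>_. 2 * D))"
    using ex_bij_betw_nat_finite finite_extensions unfolding E_def by blast
  let ?m = "card (E (\<lambda>_. 2 * D))"
  have "numbered_pattern n ?m (\<lambda>j. w (h j))"
    unfolding numbered_pattern_def using P bij_betw_trans[OF h bij] by (auto simp: comp_def atLeast0LessThan)
  moreover have "numbered_pattern n ?m h"
    unfolding numbered_pattern_def using P' bij_betw_trans[OF h bij'] by (auto simp: comp_def atLeast0LessThan)
  moreover have "\<forall>j<?m. \<forall>\<zeta>\<in>?X. f (prefix_map n (w (h j)) \<zeta>) = prefix_map n (h j) \<zeta>"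
    using w(2) bij_betwE[OF h] by auto
  ultimately show ?thesis by blast
qed

lemma openin_cell:
  assumes "\<zeta> \<in> cantor_power n"
  shows "openin (cantor_space n) {\<eta> \<in> cantor_power n. \<forall>i<n. \<forall>m<a i. \<eta> i m = \<zeta> i m}"
proof -
  have 1: "openin (cantor_space n) {\<eta> \<in> cantor_power n. \<eta> i m \<in> {\<zeta> i m}}" if "i < n" for i m
  proof (rule openin_continuous_map_preimage)
    have "continuous_map (cantor_space n) (product_topology (\<lambda>_. discrete_topology UNIV) UNIV) (\<lambda>\<eta>. \<eta> i)"
      unfolding cantor_space_def by (rule continuous_map_product_projection) (use that in simp)
    then show "continuous_map (cantor_space n) (discrete_topology UNIV) (\<lambda>\<eta>. \<eta> i m)"
      by (simp add: continuous_map_componentwise_UNIV)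
  qed simp
  have "openin (cantor_space n) (cantor_power n \<inter> (\<Inter>p\<in>Sigma {..<n} (\<lambda>i. {..<a i}). {\<eta> \<in> cantor_power n. \<eta> (fst p) (snd p) \<in> {\<zeta> (fst p) (snd p)}}))"
    by (rule openin_Int_Inter) (auto intro!: 1[simplified])
  also have "cantor_power n \<inter> (\<Inter>p\<in>Sigma {..<n} (\<lambda>i. {..<a i}). {\<eta> \<in> cantor_power n. \<eta> (fst p) (snd p) \<in> {\<zeta> (fst p) (snd p)}})
    = {\<eta> \<in> cantor_power n. \<forall>i<n. \<forall>m<a i. \<eta> i m = \<zeta> i m}" by auto
  finally show ?thesis .
qed

lemma bounded_shift_continuous:
  assumes D: "bounded_shift n D f" and maps: "\<And>x. x \<in> cantor_power n \<Longrightarrow> f x \<in> cantor_power n"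
  shows "continuous_map (cantor_space n) (cantor_space n) f"
proof -
  have "continuous_map (cantor_space n) (discrete_topology UNIV) (\<lambda>x. f x i m)" if i: "i < n" for i m
    unfolding continuous_map_def
  proof (intro conjI allI impI)
    fix U :: "bool set"
    show "openin (cantor_space n) {x \<in> cantor_power n. f x i m \<in> U}"
    proof (subst openin_subopen, intro ballI)
      fix \<zeta> assume \<zeta>: "\<zeta> \<in> {x \<in> cantor_power n. f x i m \<in> U}"
      then obtain a b where ab: "shifts n f \<zeta> a b" using D unfolding bounded_shift_def by blast
      let ?a = "\<lambda>i. a i + Suc m" and ?b = "\<lambda>i. b i + Suc m"
      have s: "shifts n f \<zeta> ?a ?b" by (rule shifts_add[OF ab]) (use \<zeta> in simp)
      let ?T = "{\<eta> \<in> cantor_power n. \<forall>i<n. \<forall>m<?a i. \<eta> i m = \<zeta> i m}"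
      have T: "?T \<subseteq> {x \<in> cantor_power n. f x i m \<in> U}"
      proof
        fix \<eta> assume \<eta>: "\<eta> \<in> ?T"
        have "\<eta> = graft n ?a \<eta> (tail ?a \<eta>)" using \<eta> graft_tail by simp
        also have "\<dots> = graft n ?a \<zeta> (tail ?a \<eta>)" by (rule graft_cong) (use \<eta> in auto)
        finally have "f \<eta> = graft n ?b (f \<zeta>) (tail ?a \<eta>)" using s unfolding shifts_def by metis
        then have "f \<eta> i m = f \<zeta> i m" using i by (simp add: graft_def)
        then show "\<eta> \<in> {x \<in> cantor_power n. f x i m \<in> U}" using \<eta> \<zeta> by simp
      qed
      show "\<exists>T. openin (cantor_space n) T \<and> \<zeta> \<in> T \<and> T \<subseteq> {x \<in> cantor_power n. f x i m \<in> U}"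
        by (rule exI[of _ ?T], intro conjI, rule openin_cell) (use \<zeta> T in simp_all)
    qed
  qed auto
  then show ?thesis
    unfolding cantor_space_def[of n] continuous_map_componentwise
    using maps by (auto simp: continuous_map_componentwise_UNIV mem_cantor_power cantor_space_def[symmetric])
qed

text \<open>In this description, closure under composition and inverses is the calculus of depths; common
  refinements of patterns are not needed any more.\<close>

lemma carrier_nV: "carrier (nV n) = {f \<in> Bij (cantor_power n). \<exists>D. bounded_shift n D f}"
proof (intro equalityI subsetI)
  fix f assume "f \<in> carrier (nV n)"
  then show "f \<in> {f \<in> Bij (cantor_power n). \<exists>D. bounded_shift n D f}"
    using nV_bounded_shift by (auto simp: nV_def homeo_group_def)
next
  fix f assume "f \<in> {f \<in> Bij (cantor_power n). \<exists>D. bounded_shift n D f}"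
  then obtain D where f: "f \<in> Bij (cantor_power n)" and D: "bounded_shift n D f" by blast
  let ?X = "cantor_power n"
  have bij: "bij_betw f ?X ?X" using f by (simp add: Bij_def)
  let ?g = "inv_into ?X f"
  have g: "?g x \<in> ?X" "f (?g x) = x" "?g (f x) = x" "f x \<in> ?X" if "x \<in> ?X" for x
    using bij that by (auto simp: bij_betw_def inv_into_into f_inv_into_f)
  have "homeomorphic_maps (cantor_space n) (cantor_space n) f ?g"
    unfolding homeomorphic_maps_def
    using bounded_shift_continuous[OF D] bounded_shift_continuous[OF bounded_shift_inverse[OF D, of ?g]] g
    by simp
  then have "homeomorphic_map (cantor_space n) (cantor_space n) f"
    by (rule homeomorphic_maps_imp_map)
  then show "f \<in> carrier (nV n)"
    using f bounded_shift_numbered[OF f D] by (simp add: nV_def homeo_group_def)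
qed

lemma nV_alt: "nV n = (BijGroup (cantor_power n))\<lparr>carrier := carrier (nV n)\<rparr>"
  by (simp add: nV_def homeo_group_def)

lemma nV_subgroup: "subgroup (carrier (nV n)) (BijGroup (cantor_power n))"
proof (rule group.subgroupI[OF group_BijGroup])
  let ?X = "cantor_power n"
  show "carrier (nV n) \<subseteq> carrier (BijGroup ?X)"
    by (auto simp: carrier_nV BijGroup_def)
  have "bounded_shift n 0 (\<lambda>x\<in>?X. x)"
    unfolding bounded_shift_def
    by (auto simp: shifts_def graft_in intro!: exI[of _ "\<lambda>_. 0"])
  then have "(\<lambda>x\<in>?X. x) \<in> carrier (nV n)" by (auto simp: carrier_nV id_Bij)
  then show "carrier (nV n) \<noteq> {}" by blast
next
  let ?X = "cantor_power n"
  fix f assume "f \<in> carrier (nV n)"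
  then obtain D where f: "f \<in> Bij ?X" and D: "bounded_shift n D f" by (auto simp: carrier_nV)
  have bij: "bij_betw f ?X ?X" using f by (simp add: Bij_def)
  have "bounded_shift n D (\<lambda>x\<in>?X. inv_into ?X f x)"
    by (rule bounded_shift_inverse[OF D])
      (use bij in \<open>auto simp: bij_betw_def inv_into_into f_inv_into_f\<close>)
  then show "inv\<^bsub>BijGroup ?X\<^esub> f \<in> carrier (nV n)"
    using f by (auto simp: inv_BijGroup carrier_nV restrict_inv_into_Bij)
next
  let ?X = "cantor_power n"
  fix f g assume "f \<in> carrier (nV n)" "g \<in> carrier (nV n)"
  then obtain D E where f: "f \<in> Bij ?X" "bounded_shift n D f" and g: "g \<in> Bij ?X" "bounded_shift n E g"
    by (auto simp: carrier_nV)
  have "bounded_shift n (E + D) (compose ?X f g)"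
    by (rule bounded_shift_comp[OF f(2) g(2)]) (use Bij_imp_funcset[OF g(1)] in \<open>auto simp: compose_def\<close>)
  then show "f \<otimes>\<^bsub>BijGroup ?X\<^esub> g \<in> carrier (nV n)"
    using f g by (auto simp: BijGroup_def carrier_nV compose_Bij)
qed

lemma nV_group: "group (nV n)"
  using subgroup.subgroup_is_group[OF nV_subgroup group_BijGroup, of n] nV_alt by metis

lemma nV_mult_apply:
  assumes "f \<in> carrier (nV n)" "g \<in> carrier (nV n)" "x \<in> cantor_power n"
  shows "(f \<otimes>\<^bsub>nV n\<^esub> g) x = f (g x)"
proof -
  have "f \<otimes>\<^bsub>nV n\<^esub> g = f \<otimes>\<^bsub>BijGroup (cantor_power n)\<^esub> g" by (subst nV_alt) simp
  then show ?thesis using assms by (simp add: BijGroup_def carrier_nV compose_def)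
qed

lemma nV_one_apply: "x \<in> cantor_power n \<Longrightarrow> \<one>\<^bsub>nV n\<^esub> x = x"
  by (subst nV_alt) (simp add: BijGroup_def)

lemma nV_maps: "f \<in> carrier (nV n) \<Longrightarrow> x \<in> cantor_power n \<Longrightarrow> f x \<in> cantor_power n"
  using Bij_imp_funcset by (auto simp: carrier_nV)

section \<open>Coarse paths in word metrics\<close>

locale generated_group = group G for G (structure) +
  fixes S
  assumes generators: "S \<subseteq> carrier G" and generate_eq: "generate G S = carrier G"
begin

abbreviation len where "len \<equiv> word_length G S"

lemma word_dist_eq: "a \<in> carrier G \<Longrightarrow> b \<in> carrier G \<Longrightarrow> word_dist G S a b = real (len (inv a \<otimes> b))"
  by (simp add: word_dist_def)

sublocale dist: Metric_space "carrier G" "word_dist G S"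
  by (rule word_dist_Metric_space[OF is_group generators generate_eq])

lemma len_inv: assumes "g \<in> carrier G" shows "len (inv g) = len g"
  using dist.commute[of \<one> g] assms by (simp add: word_dist_eq)

lemma len_mult:
  assumes "g \<in> carrier G" "h \<in> carrier G" shows "len (g \<otimes> h) \<le> len g + len h"
proof -
  have "inv g \<otimes> (g \<otimes> h) = h" using assms by (simp flip: m_assoc)
  then show ?thesis using dist.triangle[of \<one> g "g \<otimes> h"] assms by (simp add: word_dist_eq)
qed

lemma len_mult_ge:
  assumes "g \<in> carrier G" "h \<in> carrier G"
  shows "len g \<le> len (g \<otimes> h) + len h" "len h \<le> len (g \<otimes> h) + len g"
proof -
  have "g = (g \<otimes> h) \<otimes> inv h" "h = inv g \<otimes> (g \<otimes> h)"
    using assms by (simp_all add: m_assoc) (simp flip: m_assoc)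
  then show "len g \<le> len (g \<otimes> h) + len h" "len h \<le> len (g \<otimes> h) + len g"
    using len_mult[of "g \<otimes> h" "inv h"] len_mult[of "inv g" "g \<otimes> h"] assms len_inv by simp_all
qed

lemma len_conj_ge:
  assumes "g \<in> carrier G" "h \<in> carrier G"
  shows "len g \<le> len (h \<otimes> g \<otimes> inv h) + 2 * len h"
  using len_mult_ge(2)[of h g] len_mult_ge(1)[of "h \<otimes> g" "inv h"] len_inv[of h] assms by simp

lemma foldr_closed: "set xs \<subseteq> carrier G \<Longrightarrow> foldr (\<otimes>) xs \<one> \<in> carrier G"
  by (induction xs) auto

lemma word_for:
  assumes "g \<in> carrier G"
  shows "\<exists>xs. length xs = len g \<and> set xs \<subseteq> S \<union> m_inv G ` S \<and> foldr (\<otimes>) xs \<one> = g"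
proof -
  have W: "S \<union> m_inv G ` S \<subseteq> carrier G" using generators by auto
  have app: "foldr (\<otimes>) (xs @ ys) \<one> = foldr (\<otimes>) xs \<one> \<otimes> foldr (\<otimes>) ys \<one>"
    if "set xs \<subseteq> carrier G" "set ys \<subseteq> carrier G" for xs ys
    using that(1) by (induction xs) (use that(2) foldr_closed in \<open>auto simp: m_assoc\<close>)
  have "g \<in> generate G S" using assms generate_eq by simp
  then have "\<exists>xs. set xs \<subseteq> S \<union> m_inv G ` S \<and> foldr (\<otimes>) xs \<one> = g"
  proof (induction rule: generate.induct)
    case one
    show ?case by (intro exI[of _ "[]"]) simp
  next
    case (incl h)
    then show ?case using generators by (intro exI[of _ "[h]"]) auto
  next
    case (inv h)
    then show ?case using generators by (intro exI[of _ "[inv h]"]) auto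
  next
    case (eng a b)
    then obtain xs ys where *: "set xs \<subseteq> S \<union> m_inv G ` S" "foldr (\<otimes>) xs \<one> = a"
      "set ys \<subseteq> S \<union> m_inv G ` S" "foldr (\<otimes>) ys \<one> = b" by blast
    then have "foldr (\<otimes>) (xs @ ys) \<one> = a \<otimes> b" using app[of xs ys] W by blast
    then show ?case using * by (intro exI[of _ "xs @ ys"]) simp
  qed
  then have "\<exists>k xs. length xs = k \<and> set xs \<subseteq> S \<union> m_inv G ` S \<and> foldr (\<otimes>) xs \<one> = g" by blast
  then show ?thesis unfolding word_length_def by (rule LeastI_ex)
qed

lemma len_generator: assumes "x \<in> S \<union> m_inv G ` S" shows "len x \<le> 1"
  unfolding word_length_def
  by (rule Least_le, rule exI[of _ "[x]"]) (use assms generators in auto)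

text \<open>The function is given by its upper bounds, \<open>B f k\<close> saying that its value at \<open>f\<close> is at most \<open>k\<close>.\<close>

lemma subadditive_bound:
  fixes B :: "'a \<Rightarrow> nat \<Rightarrow> bool"
  assumes fin: "finite S"
    and one: "B \<one> 0"
    and mult: "\<And>f g k l. f \<in> carrier G \<Longrightarrow> g \<in> carrier G \<Longrightarrow> B f k \<Longrightarrow> B g l \<Longrightarrow> B (f \<otimes> g) (k + l)"
    and mono: "\<And>f k l. B f k \<Longrightarrow> k \<le> l \<Longrightarrow> B f l"
    and ex: "\<And>f. f \<in> carrier G \<Longrightarrow> \<exists>k. B f k"
  shows "\<exists>C. \<forall>g\<in>carrier G. B g (C * len g)"
proof -
  let ?W = "S \<union> m_inv G ` S"
  have W: "?W \<subseteq> carrier G" using generators by auto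
  then obtain k where k: "\<And>x. x \<in> ?W \<Longrightarrow> B x (k x)" using ex by (metis subsetD)
  define C where "C = (\<Sum>x\<in>?W. k x)"
  have C: "B x C" if "x \<in> ?W" for x
    using k[OF that] that fin unfolding C_def by (elim mono) (intro member_le_sum, auto)
  have "B (foldr (\<otimes>) xs \<one>) (C * length xs)" if "set xs \<subseteq> ?W" for xs
    using that
  proof (induction xs)
    case (Cons x xs)
    then have "B (x \<otimes> foldr (\<otimes>) xs \<one>) (C + C * length xs)"
      using W C by (intro mult foldr_closed) auto
    then show ?case by simp
  qed (use one in simp)
  then show ?thesis using word_for by metis
qed

text \<open>Coarse paths that stay outside the open ball of radius \<open>\<rho>\<close> around the identity. Jumps of bounded size
  are allowed since they disappear in an asymptotic cone.\<close>

definition far_steps :: "nat \<Rightarrow> nat \<Rightarrow> ('a \<times> 'a) set" where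
  "far_steps \<rho> J = {(a, b). a \<in> carrier G \<and> b \<in> carrier G \<and> \<rho> \<le> len a \<and> \<rho> \<le> len b \<and> len (inv a \<otimes> b) \<le> J}"

definition reach :: "nat \<Rightarrow> nat \<Rightarrow> nat \<Rightarrow> 'a \<Rightarrow> 'a \<Rightarrow> bool" where
  "reach \<rho> J L a b \<longleftrightarrow> (\<exists>m\<le>L. (a, b) \<in> far_steps \<rho> J ^^ m)"

lemma reach_mono: "reach \<rho> J L a b \<Longrightarrow> L \<le> L' \<Longrightarrow> reach \<rho> J L' a b"
  unfolding reach_def by (meson order_trans)

lemma reach_trans: "reach \<rho> J L a b \<Longrightarrow> reach \<rho> J L' b c \<Longrightarrow> reach \<rho> J (L + L') a c"
  unfolding reach_def by (metis add_mono relcomp.relcompI relpow_add)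

lemma far_steps_sym: "(a, b) \<in> far_steps \<rho> J \<Longrightarrow> (b, a) \<in> far_steps \<rho> J"
  using len_inv[of "inv a \<otimes> b"] by (auto simp: far_steps_def inv_mult_group)

lemma reach_sym: assumes "reach \<rho> J L a b" shows "reach \<rho> J L b a"
proof -
  have "(b, a) \<in> far_steps \<rho> J ^^ m" if "(a, b) \<in> far_steps \<rho> J ^^ m" for m
    using that
  proof (induction m arbitrary: b)
    case (Suc m)
    then obtain c where "(a, c) \<in> far_steps \<rho> J ^^ m" "(c, b) \<in> far_steps \<rho> J" by auto
    then show ?case using Suc.IH far_steps_sym relpow_Suc_I2 by metis
  qed simp
  then show ?thesis using assms unfolding reach_def by blast
qed

lemma reach_power:
  assumes a: "a \<in> carrier G" and z: "z \<in> carrier G" "len z \<le> J"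
    and far: "\<And>i. i \<le> m \<Longrightarrow> \<rho> \<le> len (a \<otimes> z [^] i)"
  shows "reach \<rho> J m a (a \<otimes> z [^] m)"
proof -
  have "(a \<otimes> z [^] i, a \<otimes> z [^] Suc i) \<in> far_steps \<rho> J" if "i < m" for i
  proof -
    have "a \<otimes> z [^] Suc i = (a \<otimes> z [^] i) \<otimes> z" using a z by (simp add: m_assoc)
    moreover have "inv (a \<otimes> z [^] i) \<otimes> ((a \<otimes> z [^] i) \<otimes> z) = z"
      using a z by (metis inv_solve_left m_closed nat_pow_closed)
    ultimately have "len (inv (a \<otimes> z [^] i) \<otimes> (a \<otimes> z [^] Suc i)) \<le> J" using z(2) by simp
    then show ?thesis using far[of i] far[of "Suc i"] that a z(1) unfolding far_steps_def by auto
  qed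
  then have "\<exists>f. f 0 = a \<and> f m = a \<otimes> z [^] m \<and> (\<forall>i<m. (f i, f (Suc i)) \<in> far_steps \<rho> J)"
    using a by (intro exI[of _ "\<lambda>i. a \<otimes> z [^] i"]) simp
  then have "(a, a \<otimes> z [^] m) \<in> far_steps \<rho> J ^^ m" unfolding relpow_fun_conv .
  then show ?thesis unfolding reach_def by blast
qed

lemma reach_word:
  assumes a: "a \<in> carrier G" and h: "h \<in> carrier G" and far: "\<rho> + len h \<le> len a" and J: "1 \<le> J"
  shows "reach \<rho> J (len h) a (a \<otimes> h)"
proof -
  have W: "S \<union> m_inv G ` S \<subseteq> carrier G" using generators by auto
  have "reach \<rho> J (length xs) a (a \<otimes> foldr (\<otimes>) xs \<one>)"
    if "set xs \<subseteq> S \<union> m_inv G ` S" "a \<in> carrier G" "\<rho> + length xs \<le> len a" for xs a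
    using that
  proof (induction xs arbitrary: a)
    case Nil
    then show ?case by (auto simp: reach_def)
  next
    case (Cons x xs)
    have x: "x \<in> S \<union> m_inv G ` S" "x \<in> carrier G" and xs: "set xs \<subseteq> carrier G" using Cons.prems(1) W by auto
    have ax: "len a \<le> len (a \<otimes> x) + 1"
      using len_mult_ge(1)[OF Cons.prems(2) x(2)] len_generator[OF x(1)] by simp
    have "inv a \<otimes> (a \<otimes> x) = x" using Cons.prems(2) x(2) by (simp flip: m_assoc)
    then have "(a, a \<otimes> x) \<in> far_steps \<rho> J"
      using Cons.prems(2,3) x ax len_generator[OF x(1)] J by (simp add: far_steps_def)
    then have "reach \<rho> J 1 a (a \<otimes> x)" unfolding reach_def by (intro exI[of _ 1]) simp
    moreover have "reach \<rho> J (length xs) (a \<otimes> x) ((a \<otimes> x) \<otimes> foldr (\<otimes>) xs \<one>)"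
      using Cons.prems x ax by (intro Cons.IH) auto
    ultimately have "reach \<rho> J (1 + length xs) a ((a \<otimes> x) \<otimes> foldr (\<otimes>) xs \<one>)" by (rule reach_trans)
    then show ?case using Cons.prems(2) x(2) foldr_closed[OF xs] by (simp add: m_assoc)
  qed
  then show ?thesis using word_for[OF h] a far by metis
qed

text \<open>Spelling \<open>h\<close>, a power of \<open>y\<close> and \<open>h\<^bsup>-1\<^esup>\<close> one after the other, every point passed is within \<open>len h\<close> of
  some \<open>a h y\<^sup>i h\<^bsup>-1\<^esup>\<close>.\<close>

lemma reach_conj_power:
  assumes a: "a \<in> carrier G" and h: "h \<in> carrier G" and y: "y \<in> carrier G" "len y \<le> J" and J: "1 \<le> J"
    and far: "\<And>i. i \<le> m \<Longrightarrow> \<rho> + len h \<le> len (a \<otimes> (h \<otimes> y [^] i \<otimes> inv h))"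
  shows "reach \<rho> J (2 * len h + m) a (a \<otimes> (h \<otimes> y [^] m \<otimes> inv h))"
proof -
  have eq: "(a \<otimes> (h \<otimes> y [^] i \<otimes> inv h)) \<otimes> h = (a \<otimes> h) \<otimes> y [^] i" for i :: nat
    using a h y(1) by (simp add: m_assoc)
  have 1: "reach \<rho> J (len h) a (a \<otimes> h)"
    using far[of 0] a h J by (intro reach_word) simp_all
  have 2: "reach \<rho> J m (a \<otimes> h) ((a \<otimes> h) \<otimes> y [^] m)"
  proof (rule reach_power)
    show "\<rho> \<le> len ((a \<otimes> h) \<otimes> y [^] i)" if "i \<le> m" for i
      using far[OF that] len_mult_ge(1)[of "a \<otimes> (h \<otimes> y [^] i \<otimes> inv h)" h] a h y(1) eq[of i] by simp
  qed (use a h y in simp_all)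
  have "reach \<rho> J (len h) (a \<otimes> (h \<otimes> y [^] m \<otimes> inv h)) ((a \<otimes> (h \<otimes> y [^] m \<otimes> inv h)) \<otimes> h)"
    using far[of m] a h y(1) J by (intro reach_word) simp_all
  then have 3: "reach \<rho> J (len h) ((a \<otimes> h) \<otimes> y [^] m) (a \<otimes> (h \<otimes> y [^] m \<otimes> inv h))"
    unfolding eq by (rule reach_sym)
  show ?thesis using reach_trans[OF reach_trans[OF 1 2] 3] by (rule reach_mono) simp
qed

text \<open>From \<open>g z\<^bsup>M\<^esup>\<close> one first multiplies by \<open>h x\<^bsup>M\<^esup> h\<^bsup>-1\<^esup>\<close> while the power of \<open>z\<close> keeps the path far from the
  identity, and then, since the two factors commute, removes the power of \<open>z\<close> while that of \<open>x\<close> does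
  this job.\<close>

lemma reach_switch:
  assumes g: "g \<in> carrier G" and h: "h \<in> carrier G" and J: "1 \<le> J"
    and x: "x \<in> carrier G" "len x \<le> J" and z: "z \<in> carrier G" "len z \<le> J"
    and comm: "\<And>i::nat. z [^] i \<otimes> (h \<otimes> x [^] M \<otimes> inv h) = (h \<otimes> x [^] M \<otimes> inv h) \<otimes> z [^] i"
    and far_x: "\<And>i. i \<le> M \<Longrightarrow> Q \<le> len (z [^] M \<otimes> (h \<otimes> x [^] i \<otimes> inv h))"
    and far_z: "\<And>i. i \<le> M \<Longrightarrow> Q \<le> len (x [^] M \<otimes> (inv h \<otimes> z [^] i \<otimes> h))"
    and Q: "\<rho> + 2 * len h + len g \<le> Q"
  shows "reach \<rho> J (2 * len h + 2 * M) (g \<otimes> z [^] M) (g \<otimes> (h \<otimes> x [^] M \<otimes> inv h))"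
proof -
  let ?k = "\<lambda>i::nat. h \<otimes> x [^] i \<otimes> inv h"
  have k: "?k i \<in> carrier G" for i using h x by simp
  have 1: "reach \<rho> J (2 * len h + M) (g \<otimes> z [^] M) ((g \<otimes> z [^] M) \<otimes> ?k M)"
  proof (rule reach_conj_power)
    fix i assume "i \<le> M"
    have "(g \<otimes> z [^] M) \<otimes> ?k i = g \<otimes> (z [^] M \<otimes> ?k i)" using g z h x by (simp add: m_assoc)
    then show "\<rho> + len h \<le> len ((g \<otimes> z [^] M) \<otimes> ?k i)"
      using far_x[OF \<open>i \<le> M\<close>] len_mult_ge(2)[OF g, of "z [^] M \<otimes> ?k i"] Q k z by simp
  qed (use g h x z J in simp_all)
  have 2: "reach \<rho> J M (g \<otimes> ?k M) ((g \<otimes> ?k M) \<otimes> z [^] M)"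
  proof (rule reach_power)
    fix i assume "i \<le> M"
    let ?y = "x [^] M \<otimes> (inv h \<otimes> z [^] i \<otimes> h)"
    have y: "?y \<in> carrier G" using x z h by simp
    have "inv h \<otimes> (z [^] i \<otimes> h) \<otimes> inv h = inv h \<otimes> z [^] i" using z h by (simp add: m_assoc)
    then have "(g \<otimes> ?k M) \<otimes> z [^] i = g \<otimes> (h \<otimes> ?y \<otimes> inv h)"
      using g z h x by (simp add: m_assoc)
    then show "\<rho> \<le> len ((g \<otimes> ?k M) \<otimes> z [^] i)"
      using far_z[OF \<open>i \<le> M\<close>] len_mult_ge(2)[OF g, of "h \<otimes> ?y \<otimes> inv h"] len_conj_ge[OF y h] Q y h by simp
  qed (use g h x z in simp_all)
  have "(g \<otimes> ?k M) \<otimes> z [^] M = (g \<otimes> z [^] M) \<otimes> ?k M"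
    by (subst (1 2) m_assoc) (use g k z comm[of M] in simp_all)
  with 2 have "reach \<rho> J M ((g \<otimes> z [^] M) \<otimes> ?k M) (g \<otimes> ?k M)" using reach_sym by simp
  from reach_trans[OF 1 this] show ?thesis by (rule reach_mono) simp
qed

end

section \<open>Pumps\<close>

text \<open>The copy of \<open>F \<times> \<dots> \<times> F\<close> that is supported in a rectangle.\<close>

definition on_rectangle ::
    "nat \<Rightarrow> (nat \<Rightarrow> bool list) \<Rightarrow> (bool word \<Rightarrow> bool word) \<Rightarrow> (nat \<Rightarrow> bool word) \<Rightarrow> (nat \<Rightarrow> bool word)" where
  "on_rectangle n c F = (\<lambda>\<zeta>\<in>cantor_power n. if \<zeta> \<in> rectangle n c
     then prefix_map n c (\<lambda>i. F (tail (\<lambda>i. length (c i)) \<zeta> i)) else \<zeta>)"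

lemma rectangleE:
  assumes "\<zeta> \<in> rectangle n c" obtains \<xi> where "\<zeta> = prefix_map n c \<xi>"
  using assms unfolding rectangle_def by blast

lemma rectangle_subset: "rectangle n c \<subseteq> cantor_power n"
  by (auto simp: mem_rectangle)

lemma prefix_map_cong: "(\<And>i. i < n \<Longrightarrow> \<xi> i = \<xi>' i) \<Longrightarrow> prefix_map n c \<xi> = prefix_map n c \<xi>'"
  unfolding prefix_map_def by (rule restrict_ext) simp

lemma tail_prefix_map: "i < n \<Longrightarrow> tail (\<lambda>i. length (c i)) (prefix_map n c \<xi>) i = \<xi> i"
  by (auto simp: tail_def prefix_map_def)

lemma on_rectangle_inside: "on_rectangle n c F (prefix_map n c \<xi>) = prefix_map n c (\<lambda>i. F (\<xi> i))"
  using prefix_map_in[of n c \<xi>] prefix_map_in_rectangle[of n c \<xi>]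
  by (simp add: on_rectangle_def tail_prefix_map cong: prefix_map_cong)

lemma on_rectangle_outside: "\<zeta> \<in> cantor_power n \<Longrightarrow> \<zeta> \<notin> rectangle n c \<Longrightarrow> on_rectangle n c F \<zeta> = \<zeta>"
  by (simp add: on_rectangle_def)

lemma graft_prefix_map:
  "graft n (\<lambda>i. length (c i) + p i) (prefix_map n c \<xi>) \<eta> = prefix_map n c (\<lambda>i. prefix (p i) (\<xi> i) \<frown> \<eta> i)"
  by (auto simp: graft_eq_prefix_map prefix_map_def fun_eq_iff)

lemma on_rectangle_nV:
  assumes inv: "\<And>w. F' (F w) = w" "\<And>w. F (F' w) = w"
    and local: "\<And>w. \<exists>p q. p \<le> 2 \<and> q \<le> 2 \<and> (\<forall>v. F (prefix p w \<frown> v) = prefix q (F w) \<frown> v)"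
  shows "on_rectangle n c F \<in> carrier (nV n)"
proof -
  let ?X = "cantor_power n" and ?f = "on_rectangle n c F" and ?g = "on_rectangle n c F'"
  have cancel: "on_rectangle n c K (on_rectangle n c L \<zeta>) = \<zeta>"
    if "\<And>w. K (L w) = w" "\<zeta> \<in> ?X" for K L \<zeta>
  proof (cases "\<zeta> \<in> rectangle n c")
    case True
    then obtain \<xi> where "\<zeta> = prefix_map n c \<xi>" by (rule rectangleE)
    then show ?thesis using that(1) by (simp add: on_rectangle_inside)
  qed (use that on_rectangle_outside in metis)
  have maps: "on_rectangle n c K ` ?X \<subseteq> ?X" for K
    by (auto simp: on_rectangle_def prefix_map_in)
  have "bij_betw ?f ?X ?X"
    by (rule bij_betw_byWitness[of _ ?g]; (intro ballI)?) (rule cancel cancel maps maps; (rule inv | assumption)?)+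
  moreover have "?f \<in> extensional ?X" by (simp add: on_rectangle_def)
  moreover have "bounded_shift n (2 + (\<Sum>i<n. length (c i))) ?f"
    unfolding bounded_shift_def
  proof
    fix \<zeta> assume \<zeta>: "\<zeta> \<in> ?X"
    have len: "length (c i) \<le> (\<Sum>i<n. length (c i))" if "i < n" for i
      by (rule member_le_sum) (use that in auto)
    show "\<exists>a b. (\<forall>i<n. a i \<le> 2 + (\<Sum>i<n. length (c i)) \<and> b i \<le> 2 + (\<Sum>i<n. length (c i))) \<and> shifts n ?f \<zeta> a b"
    proof (cases "\<zeta> \<in> rectangle n c")
      case True
      then obtain \<xi> where \<xi>: "\<zeta> = prefix_map n c \<xi>" by (rule rectangleE)
      have "\<forall>i. \<exists>pq. fst pq \<le> 2 \<and> snd pq \<le> 2 \<and> (\<forall>v. F (prefix (fst pq) (\<xi> i) \<frown> v) = prefix (snd pq) (F (\<xi> i)) \<frown> v)"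
        using local by simp
      from choice[OF this] obtain pq where pq: "\<And>i. fst (pq i) \<le> 2" "\<And>i. snd (pq i) \<le> 2"
        "\<And>i v. F (prefix (fst (pq i)) (\<xi> i) \<frown> v) = prefix (snd (pq i)) (F (\<xi> i)) \<frown> v" by blast
      let ?a = "\<lambda>i. length (c i) + fst (pq i)" and ?b = "\<lambda>i. length (c i) + snd (pq i)"
      have "shifts n ?f \<zeta> ?a ?b"
        by (simp add: shifts_def \<xi> graft_prefix_map on_rectangle_inside pq(3))
      moreover have "\<forall>i<n. ?a i \<le> 2 + (\<Sum>i<n. length (c i)) \<and> ?b i \<le> 2 + (\<Sum>i<n. length (c i))"
      proof (intro allI impI)
        fix i assume "i < n"
        then show "?a i \<le> 2 + (\<Sum>i<n. length (c i)) \<and> ?b i \<le> 2 + (\<Sum>i<n. length (c i))"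
          using len[of i] pq(1)[of i] pq(2)[of i] by linarith
      qed
      ultimately show ?thesis by (intro exI[of _ ?a] exI[of _ ?b] conjI)
    next
      case False
      let ?a = "\<lambda>i. length (c i)"
      have out: "graft n ?a \<zeta> \<eta> \<notin> rectangle n c" for \<eta>
      proof
        assume "graft n ?a \<zeta> \<eta> \<in> rectangle n c"
        then have "\<forall>i<n. prefix (?a i) (\<zeta> i) = c i"
          by (auto simp: mem_rectangle graft_eq_prefix_map prefix_map_def)
        then show False using False \<zeta> by (simp add: mem_rectangle)
      qed
      have "shifts n ?f \<zeta> ?a ?a"
        unfolding shifts_def using out on_rectangle_outside[OF graft_in] on_rectangle_outside[OF \<zeta> False] by simp
      moreover have "length (c i) \<le> 2 + (\<Sum>i<n. length (c i))" if "i < n" for i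
        using len[OF that] by linarith
      ultimately show ?thesis by (intro exI[of _ ?a]) simp
    qed
  qed
  ultimately show ?thesis by (auto simp: carrier_nV Bij_def)
qed

text \<open>A homeomorphism of the Cantor set that moves \<open>0\<eta>\<close> to \<open>00\<eta>\<close>, so that \<open>000\<dots>\<close> is a fixed point with slope one
  (a generator of Thompson's group \<open>F\<close>).\<close>

definition contract :: "bool word \<Rightarrow> bool word" where
  "contract w = (if \<not> w 0 then [False, False] \<frown> suffix 1 w
     else if \<not> w 1 then [False, True] \<frown> suffix 2 w else [True] \<frown> suffix 2 w)"

definition expand :: "bool word \<Rightarrow> bool word" where
  "expand w = (if w 0 then [True, True] \<frown> suffix 1 w
     else if w 1 then [True, False] \<frown> suffix 2 w else [False] \<frown> suffix 2 w)"

lemma suffix_build: "suffix (Suc k) (x ## v) = suffix k v"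
  by (rule ext) simp

lemma build_split: "w = w 0 ## w 1 ## suffix 2 w"
  by (metis One_nat_def build_first numeral_2_eq_2 plus_1_eq_Suc suffix_nth suffix_suffix)

lemma word_cases2:
  obtains v where "w = False ## v" | v where "w = True ## False ## v" | v where "w = True ## True ## v"
  using build_split[of w] by (metis (full_types))

lemma contract_build:
  "contract (False ## v) = False ## False ## v"
  "contract (True ## False ## v) = False ## True ## v"
  "contract (True ## True ## v) = True ## v"
  by (simp_all add: contract_def numeral_2_eq_2 suffix_build)

lemma expand_build:
  "expand (True ## v) = True ## True ## v"
  "expand (False ## True ## v) = True ## False ## v"
  "expand (False ## False ## v) = False ## v"
  by (simp_all add: expand_def numeral_2_eq_2 suffix_build)

lemma expand_contract: "expand (contract w) = w"
  by (rule word_cases2[of w]) (simp_all add: contract_build expand_build)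

lemma contract_expand: "contract (expand w) = w"
  by (subst (1 2) build_split[of w]; cases "w 0"; cases "w 1") (simp_all add: contract_build expand_build)

lemma contract_local:
  "\<exists>p q. p \<le> 2 \<and> q \<le> 2 \<and> (\<forall>v. contract (prefix p w \<frown> v) = prefix q (contract w) \<frown> v)"
proof (rule word_cases2[of w])
  fix v assume "w = False ## v"
  then show ?thesis by (intro exI[of _ 1] exI[of _ 2]) (simp add: contract_build numeral_2_eq_2)
next
  fix v assume "w = True ## False ## v"
  then show ?thesis by (intro exI[of _ 2] exI[of _ 2]) (simp add: contract_build numeral_2_eq_2)
next
  fix v assume "w = True ## True ## v"
  then show ?thesis by (intro exI[of _ 2] exI[of _ 1]) (simp add: contract_build numeral_2_eq_2)
qed

definition pump :: "nat \<Rightarrow> (nat \<Rightarrow> bool list) \<Rightarrow> (nat \<Rightarrow> bool word) \<Rightarrow> (nat \<Rightarrow> bool word)" where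
  "pump n c = on_rectangle n c contract"

text \<open>The fixed point of the pump on \<open>rectangle n c\<close>, towards which it contracts in all coordinates at once.\<close>

definition corner :: "nat \<Rightarrow> (nat \<Rightarrow> bool list) \<Rightarrow> (nat \<Rightarrow> bool word)" where
  "corner n c = prefix_map n c (\<lambda>_ _. False)"

lemma pump_nV: "pump n c \<in> carrier (nV n)"
  unfolding pump_def using expand_contract contract_expand contract_local by (rule on_rectangle_nV)

lemma corner_in: "corner n c \<in> cantor_power n"
  by (simp add: corner_def prefix_map_in)

lemma contract_False: "contract (\<lambda>_. False) = (\<lambda>_. False)"
  by (rule ext) (simp add: contract_def conc_def nth_Cons' del: build_cons)

lemma pump_corner: "pump n c (corner n c) = corner n c"
  by (simp add: pump_def corner_def on_rectangle_inside contract_False)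

lemma pump_shifts_corner:
  "shifts n (pump n c) (corner n c) (\<lambda>i. length (c i) + 1) (\<lambda>i. length (c i) + 1 + 1)"
proof -
  have "contract (prefix 1 (\<lambda>_. False) \<frown> v) = prefix 2 (\<lambda>_. False) \<frown> v" for v
    by (simp add: contract_build numeral_2_eq_2)
  then have "shifts n (pump n c) (corner n c) (\<lambda>i. length (c i) + 1) (\<lambda>i. length (c i) + 2)"
    unfolding shifts_def pump_corner
    by (intro allI) (simp only: corner_def graft_prefix_map pump_def on_rectangle_inside)
  then show ?thesis by simp
qed

definition trivial_on :: "'a set \<Rightarrow> ('a \<Rightarrow> 'a) \<Rightarrow> bool" where
  "trivial_on A v \<longleftrightarrow> (\<forall>\<xi>\<in>A. v \<xi> = \<xi>)"

lemma pump_trivial_on: "trivial_on (cantor_power n - rectangle n c) (pump n c)"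
  by (simp add: trivial_on_def pump_def on_rectangle_outside)

context
  fixes n :: nat
begin

interpretation group "nV n" by (rule nV_group)

lemma nV_inv_apply:
  assumes "f \<in> carrier (nV n)" "x \<in> cantor_power n"
  shows "(inv\<^bsub>nV n\<^esub> f) (f x) = x" "f ((inv\<^bsub>nV n\<^esub> f) x) = x"
  using nV_mult_apply[of "inv\<^bsub>nV n\<^esub> f" n f x] nV_mult_apply[of f n "inv\<^bsub>nV n\<^esub> f" x] assms
  by (simp_all add: nV_one_apply)

lemma nV_eqI:
  assumes "f \<in> carrier (nV n)" "g \<in> carrier (nV n)" "\<And>x. x \<in> cantor_power n \<Longrightarrow> f x = g x"
  shows "f = g"
  using assms by (auto simp: carrier_nV Bij_def intro: extensionalityI)

lemma trivial_on_mult: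
  assumes "f \<in> carrier (nV n)" "g \<in> carrier (nV n)" "A \<subseteq> cantor_power n" "trivial_on A f" "trivial_on A g"
  shows "trivial_on A (f \<otimes>\<^bsub>nV n\<^esub> g)"
  unfolding trivial_on_def
proof
  fix \<xi> assume \<xi>: "\<xi> \<in> A"
  then have "(f \<otimes>\<^bsub>nV n\<^esub> g) \<xi> = f (g \<xi>)" using nV_mult_apply[OF assms(1,2)] assms(3) by blast
  then show "(f \<otimes>\<^bsub>nV n\<^esub> g) \<xi> = \<xi>" using assms(4,5) \<xi> by (simp add: trivial_on_def)
qed

lemma trivial_on_inv:
  assumes "f \<in> carrier (nV n)" "A \<subseteq> cantor_power n" "trivial_on A f"
  shows "trivial_on A (inv\<^bsub>nV n\<^esub> f)"
  unfolding trivial_on_def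
proof
  fix \<xi> assume \<xi>: "\<xi> \<in> A"
  then have "(inv\<^bsub>nV n\<^esub> f) (f \<xi>) = \<xi>" using nV_inv_apply(1)[OF assms(1)] assms(2) by blast
  then show "(inv\<^bsub>nV n\<^esub> f) \<xi> = \<xi>" using assms(3) \<xi> by (simp add: trivial_on_def)
qed

lemma trivial_on_pow:
  assumes "f \<in> carrier (nV n)" "A \<subseteq> cantor_power n" "trivial_on A f"
  shows "trivial_on A (f [^]\<^bsub>nV n\<^esub> (m::nat))"
proof (induction m)
  case 0
  have "\<one>\<^bsub>nV n\<^esub> \<xi> = \<xi>" if "\<xi> \<in> A" for \<xi> using assms(2) that nV_one_apply by blast
  then show ?case by (simp add: trivial_on_def)
next
  case (Suc m)
  then show ?case using trivial_on_mult[OF _ assms(1,2) Suc assms(3)] assms(1) by simp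
qed

lemma trivial_on_conj:
  assumes h: "h \<in> carrier (nV n)" and v: "v \<in> carrier (nV n)" "trivial_on B v"
    and A: "A \<subseteq> cantor_power n" "\<And>\<xi>. \<xi> \<in> A \<Longrightarrow> (inv\<^bsub>nV n\<^esub> h) \<xi> \<in> B"
  shows "trivial_on A (h \<otimes>\<^bsub>nV n\<^esub> v \<otimes>\<^bsub>nV n\<^esub> inv\<^bsub>nV n\<^esub> h)"
  unfolding trivial_on_def
proof
  fix \<xi> assume \<xi>: "\<xi> \<in> A"
  then have xi_mem: "\<xi> \<in> cantor_power n" using A(1) by blast
  have iX: "(inv\<^bsub>nV n\<^esub> h) \<xi> \<in> cantor_power n" using nV_maps[of "inv\<^bsub>nV n\<^esub> h"] h xi_mem by simp
  have "v ((inv\<^bsub>nV n\<^esub> h) \<xi>) = (inv\<^bsub>nV n\<^esub> h) \<xi>" using v(2) A(2)[OF \<xi>] by (simp add: trivial_on_def)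
  then show "(h \<otimes>\<^bsub>nV n\<^esub> v \<otimes>\<^bsub>nV n\<^esub> inv\<^bsub>nV n\<^esub> h) \<xi> = \<xi>"
    using h v(1) xi_mem iX by (simp add: nV_mult_apply nV_inv_apply)
qed

lemma trivial_on_complement:
  assumes v: "v \<in> carrier (nV n)" "trivial_on A v" "A \<subseteq> cantor_power n" and \<xi>: "\<xi> \<in> cantor_power n" "\<xi> \<notin> A"
  shows "v \<xi> \<notin> A"
proof
  assume "v \<xi> \<in> A"
  then have "v (v \<xi>) = v \<xi>" using v(2) by (simp add: trivial_on_def)
  then have "v \<xi> = \<xi>"
    using nV_inv_apply(1)[OF v(1) \<xi>(1)] nV_inv_apply(1)[OF v(1) nV_maps[OF v(1) \<xi>(1)]] by simp
  then show False using \<open>v \<xi> \<in> A\<close> \<xi>(2) by simp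
qed

text \<open>The support of \<open>u\<close> lies in \<open>A\<close> and that of \<open>v\<close> outside; both preserve \<open>A\<close>, so that at each point only
  one of them matters.\<close>

lemma trivial_on_commute:
  assumes u: "u \<in> carrier (nV n)" "trivial_on (cantor_power n - A) u" and v: "v \<in> carrier (nV n)" "trivial_on A v" and A: "A \<subseteq> cantor_power n"
  shows "u \<otimes>\<^bsub>nV n\<^esub> v = v \<otimes>\<^bsub>nV n\<^esub> u"
proof (rule nV_eqI)
  fix \<xi> assume \<xi>: "\<xi> \<in> cantor_power n"
  have "u (v \<xi>) = v (u \<xi>)"
  proof (cases "\<xi> \<in> A")
    case True
    then have "u \<xi> \<notin> cantor_power n - A" using trivial_on_complement[OF u] \<xi> by blast
    then have "u \<xi> \<in> A" using nV_maps[OF u(1) \<xi>] by blast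
    then show ?thesis using v(2) True by (simp add: trivial_on_def)
  next
    case False
    then have "v \<xi> \<in> cantor_power n - A" using trivial_on_complement[OF v A \<xi>] nV_maps[OF v(1) \<xi>] by blast
    then show ?thesis using u(2) False \<xi> by (simp add: trivial_on_def)
  qed
  then show "(u \<otimes>\<^bsub>nV n\<^esub> v) \<xi> = (v \<otimes>\<^bsub>nV n\<^esub> u) \<xi>" using u v \<xi> by (simp add: nV_mult_apply)
qed (use u v in simp_all)

lemma shifts_pow:
  assumes f: "f \<in> carrier (nV n)" and \<zeta>: "\<zeta> \<in> cantor_power n" "f \<zeta> = \<zeta>" and s: "shifts n f \<zeta> a (\<lambda>i. a i + 1)"
  shows "(f [^]\<^bsub>nV n\<^esub> m) \<zeta> = \<zeta> \<and> shifts n (f [^]\<^bsub>nV n\<^esub> m) \<zeta> a (\<lambda>i. a i + m)"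
proof (induction m)
  case 0
  then show ?case using \<zeta> by (simp add: nV_one_apply shifts_def graft_in)
next
  case (Suc m)
  have "shifts n (f [^]\<^bsub>nV n\<^esub> m) \<zeta> (\<lambda>i. a i + 1) (\<lambda>i. a i + m + 1)"
    by (rule shifts_add) (use Suc \<zeta> in simp_all)
  then have "shifts n (f [^]\<^bsub>nV n\<^esub> Suc m) \<zeta> a (\<lambda>i. a i + m + 1)"
    by (intro shifts_comp[OF s, of "f [^]\<^bsub>nV n\<^esub> m"]) (use f \<zeta> in \<open>simp_all add: nV_mult_apply\<close>)
  then show ?case using Suc f \<zeta> by (simp add: nV_mult_apply)
qed

end

section \<open>Lower bounds for word lengths\<close>

lemma (in generated_group) len_pow: "x \<in> carrier G \<Longrightarrow> len (x [^] (i::nat)) \<le> i * len x"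
proof (induction i)
  case 0
  have "len \<one> \<le> 0" unfolding word_length_def by (rule Least_le) (rule exI[of _ "[]"], simp)
  then show ?case by simp
next
  case (Suc i)
  then show ?case using len_mult[of "x [^] i" x] by simp
qed

lemma trivial_on_subset: "trivial_on B v \<Longrightarrow> A \<subseteq> B \<Longrightarrow> trivial_on A v"
  unfolding trivial_on_def by blast

context
  fixes n :: nat and S
  assumes n: "1 \<le> n" and gen: "generated_group (nV n) S"
begin

interpretation generated_group "nV n" S by (rule gen)

text \<open>Everything that is known about the word metric from below comes from this estimate.\<close>

lemma depth_bound:
  assumes "finite S"
  shows "\<exists>C\<ge>1. \<forall>g\<in>carrier (nV n). bounded_shift n (C * len g) g"
proof -
  have "\<exists>C. \<forall>g\<in>carrier (nV n). bounded_shift n (C * len g) g"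
  proof (rule subadditive_bound[OF assms, where B = "\<lambda>g k. bounded_shift n k g"])
    show "bounded_shift n 0 \<one>\<^bsub>nV n\<^esub>"
      unfolding bounded_shift_def
      by (intro ballI exI[of _ "\<lambda>_. 0"]) (simp add: shifts_def nV_one_apply graft_in)
    show "bounded_shift n (k + l) (f \<otimes>\<^bsub>nV n\<^esub> g)"
      if "f \<in> carrier (nV n)" "g \<in> carrier (nV n)" "bounded_shift n k f" "bounded_shift n l g" for f g k l
      using bounded_shift_comp[OF that(3,4), of "f \<otimes>\<^bsub>nV n\<^esub> g"] nV_maps[OF that(2)] nV_mult_apply[OF that(1,2)]
      by (simp add: add.commute)
    show "bounded_shift n l f" if "bounded_shift n k f" "k \<le> l" for f k l
      using that by (rule bounded_shift_mono)
    show "\<exists>k. bounded_shift n k f" if "f \<in> carrier (nV n)" for f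
      using that by (rule nV_bounded_shift)
  qed
  then obtain C where C: "\<forall>g\<in>carrier (nV n). bounded_shift n (C * len g) g" by blast
  have "bounded_shift n (Suc C * len g) g" if "g \<in> carrier (nV n)" for g
    by (rule bounded_shift_mono[of n "C * len g" g]) (use C that in simp_all)
  then show ?thesis by (intro exI[of _ "Suc C"]) simp
qed

context
  fixes C :: nat
  assumes C: "1 \<le> C" and depth: "\<And>g. g \<in> carrier (nV n) \<Longrightarrow> bounded_shift n (C * len g) g"
begin

lemma slope_bound:
  assumes g: "g \<in> carrier (nV n)" and \<zeta>: "\<zeta> \<in> cantor_power n" and s: "shifts n g \<zeta> a b"
  shows "b 0 \<le> a 0 + C * len g" "a 0 \<le> b 0 + C * len g"
proof -
  obtain a' b' where ab: "\<forall>i<n. a' i \<le> C * len g \<and> b' i \<le> C * len g" "shifts n g \<zeta> a' b'"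
    using depth[OF g] \<zeta> unfolding bounded_shift_def by blast
  have "b 0 + a' 0 = b' 0 + a 0" by (rule shifts_unique[OF s ab(2) \<zeta>]) (use n in simp)
  moreover have "a' 0 \<le> C * len g" "b' 0 \<le> C * len g" using ab(1) n by simp_all
  ultimately show "b 0 \<le> a 0 + C * len g" "a 0 \<le> b 0 + C * len g" by linarith+
qed

text \<open>Multiplying by anything that is the identity on the support of a pump cannot make its powers shorter:
  the slope of the product at the corner is still \<open>m\<close>.\<close>

lemma pump_bound:
  assumes z: "z = pump n c \<or> z = inv\<^bsub>nV n\<^esub> pump n c"
    and v: "v \<in> carrier (nV n)" "trivial_on (rectangle n c) v"
  shows "m \<le> C * len (z [^]\<^bsub>nV n\<^esub> m \<otimes>\<^bsub>nV n\<^esub> v)"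
proof -
  let ?\<zeta> = "corner n c" and ?a = "\<lambda>i. length (c i) + 1"
  let ?x = "pump n c [^]\<^bsub>nV n\<^esub> m"
  have \<zeta>: "?\<zeta> \<in> rectangle n c" by (simp add: corner_def prefix_map_in_rectangle)
  have x: "?x ?\<zeta> = ?\<zeta>" "shifts n ?x ?\<zeta> ?a (\<lambda>i. ?a i + m)"
    using shifts_pow[OF pump_nV corner_in pump_corner pump_shifts_corner, where m = m] by simp_all
  have v\<zeta>: "v ?\<zeta> = ?\<zeta>" using v(2) \<zeta> by (simp add: trivial_on_def)
  have sv: "shifts n v ?\<zeta> (\<lambda>i. length (c i) + l i) (\<lambda>i. length (c i) + l i)" for l
  proof -
    have "graft n (\<lambda>i. length (c i) + l i) ?\<zeta> \<xi> \<in> rectangle n c" for \<xi>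
      unfolding corner_def graft_prefix_map by (rule prefix_map_in_rectangle)
    then show ?thesis using v(2) v\<zeta> by (simp add: shifts_def trivial_on_def)
  qed
  show ?thesis using z
  proof
    assume z: "z = pump n c"
    have "shifts n (?x \<otimes>\<^bsub>nV n\<^esub> v) ?\<zeta> ?a (\<lambda>i. ?a i + m)"
      by (rule shifts_comp[where g = v and f = ?x and b = ?a])
        (use sv[of "\<lambda>_. 1"] x v\<zeta> v(1) pump_nV corner_in in \<open>simp_all add: nV_mult_apply\<close>)
    from slope_bound(1)[OF _ corner_in this] show ?thesis using v(1) z pump_nV by simp
  next
    assume z: "z = inv\<^bsub>nV n\<^esub> pump n c"
    have "shifts n (inv\<^bsub>nV n\<^esub> ?x) (?x ?\<zeta>) (\<lambda>i. ?a i + m) ?a"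
      by (rule shifts_inverse[OF x(2) corner_in]) (rule nV_inv_apply, simp_all add: pump_nV)
    moreover have "z [^]\<^bsub>nV n\<^esub> m = inv\<^bsub>nV n\<^esub> ?x" unfolding z by (rule nat_pow_inv[OF pump_nV])
    ultimately have s: "shifts n (z [^]\<^bsub>nV n\<^esub> m) ?\<zeta> (\<lambda>i. ?a i + m) ?a" using x(1) by simp
    have zc: "z [^]\<^bsub>nV n\<^esub> m \<in> carrier (nV n)" using z pump_nV by simp
    have "shifts n (z [^]\<^bsub>nV n\<^esub> m \<otimes>\<^bsub>nV n\<^esub> v) ?\<zeta> (\<lambda>i. ?a i + m) ?a"
      by (rule shifts_comp[where g = v and f = "z [^]\<^bsub>nV n\<^esub> m" and b = "\<lambda>i. ?a i + m"])
        (use sv[of "\<lambda>_. 1 + m"] s v\<zeta> v(1) zc corner_in in \<open>simp_all add: nV_mult_apply add.assoc\<close>)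
    from slope_bound(2)[OF _ corner_in this] show ?thesis using v(1) zc by simp
  qed
qed

text \<open>The hypothesis on \<open>h\<close> says that \<open>h\<close> conjugates the first pump to a map whose support is disjoint from
  that of the second one. So the two commute, and either of them keeps products with the other far
  from the identity.\<close>

lemma pump_switch:
  assumes g: "g \<in> carrier (nV n)" and h: "h \<in> carrier (nV n)" and J: "1 \<le> J"
    and z: "z = pump n d \<or> z = inv\<^bsub>nV n\<^esub> pump n d" "len z \<le> J" and x: "len (pump n c) \<le> J"
    and disj: "\<And>\<xi>. \<xi> \<in> rectangle n c \<Longrightarrow> h \<xi> \<notin> rectangle n d"
    and Q: "\<rho> + 2 * len h + len g \<le> Q"
  shows "reach \<rho> J (2 * len h + 2 * (C * Q)) (g \<otimes>\<^bsub>nV n\<^esub> z [^]\<^bsub>nV n\<^esub> (C * Q))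
    (g \<otimes>\<^bsub>nV n\<^esub> (h \<otimes>\<^bsub>nV n\<^esub> pump n c [^]\<^bsub>nV n\<^esub> (C * Q) \<otimes>\<^bsub>nV n\<^esub> inv\<^bsub>nV n\<^esub> h))"
proof (rule reach_switch[OF g h J pump_nV x _ z(2) _ _ _ Q])
  let ?X = "cantor_power n" and ?x = "pump n c"
  let ?pow = "\<lambda>z (i::nat). z [^]\<^bsub>nV n\<^esub> i" and ?mult = "\<lambda>a b. a \<otimes>\<^bsub>nV n\<^esub> b"
  let ?k = "\<lambda>i. ?mult (?mult h (?pow ?x i)) (inv\<^bsub>nV n\<^esub> h)"
  have xc: "?x \<in> carrier (nV n)" by (rule pump_nV)
  show zc: "z \<in> carrier (nV n)" using z(1) pump_nV by auto
  have k: "?k i \<in> carrier (nV n)" for i using h xc by simp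
  have sub: "rectangle n c \<subseteq> ?X" "rectangle n d \<subseteq> ?X" by (rule rectangle_subset)+
  have z_triv: "trivial_on (?X - rectangle n d) (?pow z i)" for i
  proof (rule trivial_on_pow[OF zc])
    show "trivial_on (?X - rectangle n d) z" using z(1)
    proof
      assume "z = inv\<^bsub>nV n\<^esub> pump n d"
      then show ?thesis using trivial_on_inv[OF pump_nV Diff_subset pump_trivial_on] by simp
    qed (simp add: pump_trivial_on)
  qed blast
  have k_triv: "trivial_on (rectangle n d) (?k i)" for i
  proof (rule trivial_on_conj[OF h])
    show "trivial_on (?X - rectangle n c) (?pow ?x i)"
      by (rule trivial_on_pow[OF xc _ pump_trivial_on]) blast
    fix \<eta> assume \<eta>: "\<eta> \<in> rectangle n d"
    then have "\<eta> \<in> ?X" using sub by blast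
    then have "(inv\<^bsub>nV n\<^esub> h) \<eta> \<in> ?X" "h ((inv\<^bsub>nV n\<^esub> h) \<eta>) = \<eta>"
      using nV_maps[of "inv\<^bsub>nV n\<^esub> h"] nV_inv_apply(2)[OF h] h by simp_all
    then show "(inv\<^bsub>nV n\<^esub> h) \<eta> \<in> ?X - rectangle n c"
      using disj[of "(inv\<^bsub>nV n\<^esub> h) \<eta>"] \<eta> by (intro DiffI notI) simp_all
  qed (use xc sub in simp_all)
  show "?mult (?pow z i) (?k (C * Q)) = ?mult (?k (C * Q)) (?pow z i)" for i
    by (rule trivial_on_commute[OF _ z_triv k k_triv sub(2)]) (use zc in simp)
  show "Q \<le> len (?mult (?pow z (C * Q)) (?k i))" for i
    using pump_bound[OF z(1) k k_triv, of "C * Q" i] C by simp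
  show "Q \<le> len (?mult (?pow ?x (C * Q)) (?mult (?mult (inv\<^bsub>nV n\<^esub> h) (?pow z i)) h))" for i
  proof -
    have "trivial_on (rectangle n c) (?mult (?mult (inv\<^bsub>nV n\<^esub> h) (?pow z i)) (inv\<^bsub>nV n\<^esub> (inv\<^bsub>nV n\<^esub> h)))"
    proof (rule trivial_on_conj[OF _ _ z_triv])
      show "(inv\<^bsub>nV n\<^esub> (inv\<^bsub>nV n\<^esub> h)) \<xi> \<in> ?X - rectangle n d" if "\<xi> \<in> rectangle n c" for \<xi>
        using disj[OF that] nV_maps[OF h, of \<xi>] that sub(1) h by (intro DiffI) (simp_all add: subsetD)
    qed (use h zc sub in simp_all)
    then have "trivial_on (rectangle n c) (?mult (?mult (inv\<^bsub>nV n\<^esub> h) (?pow z i)) h)" using h by simp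
    from pump_bound[OF disjI1[OF refl] _ this, of "C * Q"] show ?thesis using C h zc by simp
  qed
qed

end

end

section \<open>Linear divergence of nV\<close>

definition half :: "bool \<Rightarrow> nat \<Rightarrow> bool list" where
  "half x = (\<lambda>i. if i = 0 then [x] else [])"

text \<open>The cell of one letter more than \<open>half False\<close> around the corner of that half: there the pump of the half
  appends exactly one letter \<open>False\<close> to every coordinate.\<close>

definition near_corner :: "nat \<Rightarrow> bool list" where
  "near_corner = (\<lambda>i. half False i @ [False])"

lemma mem_half: "1 \<le> n \<Longrightarrow> \<xi> \<in> rectangle n (half x) \<longleftrightarrow> \<xi> \<in> cantor_power n \<and> \<xi> 0 0 = x"
  by (auto simp: mem_rectangle half_def)

lemma near_corner_half: "rectangle n near_corner \<subseteq> rectangle n (half False)"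
  by (auto simp: mem_rectangle half_def near_corner_def)

lemma near_corner_graft:
  assumes "\<xi> \<in> rectangle n near_corner"
  shows "\<xi> = graft n (\<lambda>i. length (half False i) + 1) (corner n (half False)) (tail (\<lambda>i. length (half False i) + 1) \<xi>)"
    (is "_ = graft n ?a ?\<zeta> _")
proof -
  have X: "\<xi> \<in> cantor_power n" using assms by (simp add: mem_rectangle)
  have "\<xi> i m = ?\<zeta> i m" if i: "i < n" and m: "m < ?a i" for i m
  proof -
    have "prefix (?a i) (\<xi> i) = near_corner i"
      using assms i by (auto simp: mem_rectangle near_corner_def)
    then have "\<xi> i m = near_corner i ! m" using m by (metis add_0 diff_zero subsequence_nth)
    also have "\<dots> = False" using m by (auto simp: near_corner_def half_def nth_Cons' less_Suc_eq split: if_splits)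
    also have "\<dots> = ?\<zeta> i m"
      using i by (auto simp: corner_def prefix_map_def half_def conc_def nth_Cons')
    finally show ?thesis .
  qed
  then have "graft n ?a ?\<zeta> (tail ?a \<xi>) = graft n ?a \<xi> (tail ?a \<xi>)" by (intro graft_cong) simp_all
  then show ?thesis using graft_tail[OF X] by simp
qed

context
  fixes n :: nat and S and C :: nat
  assumes n: "1 \<le> n" and gen: "generated_group (nV n) S" and C: "1 \<le> C"
    and depth: "\<And>g. g \<in> carrier (nV n) \<Longrightarrow> bounded_shift n (C * word_length (nV n) S g) g"
begin

interpretation generated_group "nV n" S by (rule gen)

text \<open>Powers of the pump shrink \<open>rectangle n near_corner\<close> until \<open>g\<close> replaces a prefix on it and some letters
  of the image are fixed; one letter in coordinate \<open>0\<close> is enough to know in which half the image lies.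
  The exponent is linear in the length of \<open>g\<close>.\<close>

lemma pump_into_half:
  assumes g: "g \<in> carrier (nV n)" and k: "C * len g \<le> k" and \<xi>: "\<xi> \<in> rectangle n near_corner"
  shows "(g \<otimes>\<^bsub>nV n\<^esub> pump n (half False) [^]\<^bsub>nV n\<^esub> k) \<xi> 0 0 = g (corner n (half False)) 0 0"
proof -
  let ?\<zeta> = "corner n (half False)" and ?a = "\<lambda>i. length (half False i) + 1"
  let ?t = "pump n (half False) [^]\<^bsub>nV n\<^esub> k"
  have X: "\<xi> \<in> cantor_power n" using \<xi> by (simp add: mem_rectangle)
  have t: "?t ?\<zeta> = ?\<zeta>" "shifts n ?t ?\<zeta> ?a (\<lambda>i. ?a i + k)"
    using shifts_pow[OF pump_nV corner_in pump_corner pump_shifts_corner, where m = k] by simp_all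
  obtain a b where ab: "\<forall>i<n. a i \<le> C * len g \<and> b i \<le> C * len g" "shifts n g ?\<zeta> a b"
    using depth[OF g] corner_in unfolding bounded_shift_def by blast
  let ?b = "\<lambda>i. b i + ((?a i + k) - a i)"
  have s: "shifts n g ?\<zeta> (\<lambda>i. ?a i + k) ?b"
    by (rule shifts_raise_source[OF ab(2) corner_in]) (use ab(1) k in \<open>meson order_trans trans_le_add2\<close>)
  have "?t \<xi> = graft n (\<lambda>i. ?a i + k) ?\<zeta> (tail ?a \<xi>)"
    using t near_corner_graft[OF \<xi>] unfolding shifts_def by metis
  then have "(g \<otimes>\<^bsub>nV n\<^esub> ?t) \<xi> = graft n ?b (g ?\<zeta>) (tail ?a \<xi>)"
    using s g X pump_nV by (simp add: shifts_def nV_mult_apply)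
  moreover have "0 < ?b 0" using ab(1) n k by (auto simp: trans_le_add2 less_eq_Suc_le Suc_diff_le)
  ultimately show ?thesis using n by (simp add: graft_def)
qed

text \<open>A line through \<open>g\<close> that is a quasigeodesic cannot come close to the identity on both sides of \<open>g\<close>:
  the two near points would be at a small distance from each other, but far apart on the line.\<close>

lemma pump_ray_escapes:
  assumes g: "g \<in> carrier (nV n)" and J: "len (pump n c) \<le> J" and far: "(1 + C * J) * \<rho> \<le> len g"
  shows "\<exists>z. (z = pump n c \<or> z = inv\<^bsub>nV n\<^esub> pump n c) \<and> (\<forall>i::nat. \<rho> \<le> len (g \<otimes>\<^bsub>nV n\<^esub> z [^]\<^bsub>nV n\<^esub> i))"
proof (rule ccontr)
  assume no: "\<not> ?thesis"
  let ?x = "pump n c" and ?y = "inv\<^bsub>nV n\<^esub> pump n c"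
  have x: "?x \<in> carrier (nV n)" and y: "?y \<in> carrier (nV n)" using pump_nV by simp_all
  obtain i j :: nat where i: "len (g \<otimes>\<^bsub>nV n\<^esub> ?x [^]\<^bsub>nV n\<^esub> i) < \<rho>"
    and j: "len (g \<otimes>\<^bsub>nV n\<^esub> ?y [^]\<^bsub>nV n\<^esub> j) < \<rho>"
  proof -
    have "\<not> (\<forall>i::nat. \<rho> \<le> len (g \<otimes>\<^bsub>nV n\<^esub> ?x [^]\<^bsub>nV n\<^esub> i))"
      and "\<not> (\<forall>j::nat. \<rho> \<le> len (g \<otimes>\<^bsub>nV n\<^esub> ?y [^]\<^bsub>nV n\<^esub> j))" using no by blast+
    then show ?thesis using that by (auto simp: not_le)
  qed
  have long: "C * \<rho> < l" if z: "z \<in> carrier (nV n)" "len z \<le> J"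
    and l: "len (g \<otimes>\<^bsub>nV n\<^esub> z [^]\<^bsub>nV n\<^esub> l) < \<rho>" for z l
  proof -
    have "len g \<le> len (g \<otimes>\<^bsub>nV n\<^esub> z [^]\<^bsub>nV n\<^esub> l) + len (z [^]\<^bsub>nV n\<^esub> l)"
      using len_mult_ge(1)[OF g, of "z [^]\<^bsub>nV n\<^esub> l"] z(1) by simp
    also have "\<dots> < \<rho> + l * J" using l len_pow[OF z(1), of l] z(2) by (meson add_less_le_mono le_trans mult_le_mono2)
    finally have "len g < \<rho> + l * J" .
    moreover have "(1 + C * J) * \<rho> = \<rho> + (C * \<rho>) * J" by (simp add: algebra_simps)
    ultimately have "(C * \<rho>) * J < l * J" using far by linarith
    then show ?thesis by simp
  qed
  have "?x [^]\<^bsub>nV n\<^esub> (j + i) = inv\<^bsub>nV n\<^esub> (g \<otimes>\<^bsub>nV n\<^esub> ?y [^]\<^bsub>nV n\<^esub> j) \<otimes>\<^bsub>nV n\<^esub> (g \<otimes>\<^bsub>nV n\<^esub> ?x [^]\<^bsub>nV n\<^esub> i)"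
  proof -
    have "inv\<^bsub>nV n\<^esub> (g \<otimes>\<^bsub>nV n\<^esub> ?y [^]\<^bsub>nV n\<^esub> j) = ?x [^]\<^bsub>nV n\<^esub> j \<otimes>\<^bsub>nV n\<^esub> inv\<^bsub>nV n\<^esub> g"
      using g x by (simp add: inv_mult_group nat_pow_inv)
    moreover have "inv\<^bsub>nV n\<^esub> g \<otimes>\<^bsub>nV n\<^esub> (g \<otimes>\<^bsub>nV n\<^esub> ?x [^]\<^bsub>nV n\<^esub> i) = ?x [^]\<^bsub>nV n\<^esub> i"
      using g x by (simp flip: m_assoc)
    ultimately show ?thesis using g x by (simp add: m_assoc nat_pow_mult)
  qed
  then have "len (?x [^]\<^bsub>nV n\<^esub> (j + i)) \<le> len (g \<otimes>\<^bsub>nV n\<^esub> ?y [^]\<^bsub>nV n\<^esub> j) + len (g \<otimes>\<^bsub>nV n\<^esub> ?x [^]\<^bsub>nV n\<^esub> i)"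
    using len_mult[of "inv\<^bsub>nV n\<^esub> (g \<otimes>\<^bsub>nV n\<^esub> ?y [^]\<^bsub>nV n\<^esub> j)" "g \<otimes>\<^bsub>nV n\<^esub> ?x [^]\<^bsub>nV n\<^esub> i"]
      len_inv[of "g \<otimes>\<^bsub>nV n\<^esub> ?y [^]\<^bsub>nV n\<^esub> j"] g x y by simp
  then have "len (?x [^]\<^bsub>nV n\<^esub> (j + i)) \<le> 2 * \<rho>" using i j by simp
  then have "C * len (?x [^]\<^bsub>nV n\<^esub> (j + i)) \<le> C * (2 * \<rho>)" by simp
  moreover have "j + i \<le> C * len (?x [^]\<^bsub>nV n\<^esub> (j + i))"
  proof -
    have "trivial_on (rectangle n c) \<one>\<^bsub>nV n\<^esub>"
      using rectangle_subset[of n c] nV_one_apply by (auto simp: trivial_on_def)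
    from pump_bound[OF n gen C depth disjI1[OF refl] one_closed this, of "j + i"] show ?thesis using x by simp
  qed
  moreover have "C * \<rho> < i" using long[OF x J i] .
  moreover have "C * \<rho> < j" using long[OF y _ j] J len_inv[OF x] by simp
  ultimately show False by linarith
qed

text \<open>The journey is
  \<open>g \<rightarrow> g z\<^bsup>M\<^esup> \<rightarrow> g t x\<^bsup>M\<^esup> t\<^bsup>-1\<^esup> \<rightarrow> g t x\<^bsup>M\<^esup> t\<^bsup>-1\<^esup> g\<^bsup>-1\<^esup> \<rightarrow> y\<^bsup>M\<^esup> \<rightarrow> x\<^sub>1\<^bsup>M\<^esup>\<close>
  with \<open>M = C * Q\<close>. Here \<open>z\<close> is the pump \<open>x\<^sub>1\<close> of one half or its inverse, \<open>t\<close> is a power of the pump of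
  the other half, \<open>x\<close> is the pump near the corner, and \<open>y\<close> is one of \<open>x\<close> and \<open>x\<^sub>1\<close>, chosen such that
  \<open>g t\<close> moves the support of \<open>x\<close> off that of \<open>y\<close>. The second, fourth and fifth arrow exchange two
  commuting pumps, and the third one is affordable because \<open>Q\<close> exceeds the length of \<open>g\<close> by a margin.\<close>

lemma reach_pump_power:
  assumes g: "g \<in> carrier (nV n)" and r: "len g \<le> r"
    and J: "1 \<le> J" "len (pump n near_corner) \<le> J" "len (pump n (half False)) \<le> J" "len (pump n (half True)) \<le> J"
    and far: "(1 + C * J) * \<rho> \<le> len g"
  defines "k \<equiv> C * r"
  defines "Q \<equiv> \<rho> + 2 * r + 2 * (k * J)"
  shows "reach \<rho> J (7 * (C * Q) + 4 * (k * J) + 3 * r) g (pump n (half True) [^]\<^bsub>nV n\<^esub> (C * Q))"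
proof -
  let ?c0 = near_corner and ?c1 = "half True"
  let ?x0 = "pump n ?c0" and ?x1 = "pump n ?c1" and ?t = "pump n (half False) [^]\<^bsub>nV n\<^esub> k"
  let ?pow = "\<lambda>z. z [^]\<^bsub>nV n\<^esub> (C * Q)"
  let ?conj = "\<lambda>h. h \<otimes>\<^bsub>nV n\<^esub> ?pow ?x0 \<otimes>\<^bsub>nV n\<^esub> inv\<^bsub>nV n\<^esub> h"
  have x0: "?x0 \<in> carrier (nV n)" and x1: "?x1 \<in> carrier (nV n)" and t: "?t \<in> carrier (nV n)"
    using pump_nV by simp_all
  have len_t: "len ?t \<le> k * J"
    using len_pow[OF pump_nV[of n "half False"], of k] J(3) by (meson le_trans mult_le_mono2)
  have disj01: "\<xi> \<notin> rectangle n ?c1" if "\<xi> \<in> rectangle n ?c0" for \<xi>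
    using that near_corner_half[of n] n by (auto simp: mem_half)
  obtain z where z: "z = ?x1 \<or> z = inv\<^bsub>nV n\<^esub> ?x1"
    and ray: "\<And>i::nat. \<rho> \<le> len (g \<otimes>\<^bsub>nV n\<^esub> z [^]\<^bsub>nV n\<^esub> i)"
    using pump_ray_escapes[OF g J(4) far] by blast
  have zc: "z \<in> carrier (nV n)" and lz: "len z \<le> J" using z x1 len_inv[OF x1] J(4) by auto
  have 1: "reach \<rho> J (C * Q) g (g \<otimes>\<^bsub>nV n\<^esub> ?pow z)"
    by (rule reach_power[OF g zc lz ray])
  have 2: "reach \<rho> J (2 * len ?t + 2 * (C * Q)) (g \<otimes>\<^bsub>nV n\<^esub> ?pow z) (g \<otimes>\<^bsub>nV n\<^esub> ?conj ?t)"
  proof (rule pump_switch[OF n gen C depth g t J(1) z lz J(2)])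
    show "\<rho> + 2 * len ?t + len g \<le> Q" using len_t r by (simp add: Q_def)
    fix \<xi> assume \<xi>: "\<xi> \<in> rectangle n ?c0"
    have tr: "trivial_on (rectangle n ?c1) ?t"
    proof (rule trivial_on_pow[OF pump_nV rectangle_subset])
      show "trivial_on (rectangle n ?c1) (pump n (half False))"
        by (rule trivial_on_subset[OF pump_trivial_on]) (use n in \<open>auto simp: mem_half\<close>)
    qed
    show "?t \<xi> \<notin> rectangle n ?c1"
      by (rule trivial_on_complement[OF t tr rectangle_subset]) (use \<xi> disj01 rectangle_subset in blast)+
  qed
  let ?h = "g \<otimes>\<^bsub>nV n\<^esub> ?t"
  have h: "?h \<in> carrier (nV n)" using g t by simp
  have len_h: "len ?h \<le> r + k * J" using len_mult[OF g t] r len_t by simp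
  have x0Q: "Q \<le> len (?pow ?x0)"
  proof -
    have "trivial_on (rectangle n ?c0) \<one>\<^bsub>nV n\<^esub>"
      using rectangle_subset[of n ?c0] nV_one_apply by (auto simp: trivial_on_def)
    from pump_bound[OF n gen C depth disjI1[OF refl] one_closed this, of "C * Q"] show ?thesis using x0 C by simp
  qed
  have "len (?pow ?x0) \<le> len (?conj ?t) + 2 * len ?t" by (rule len_conj_ge) (use x0 t in simp_all)
  moreover have "len (?conj ?t) \<le> len (g \<otimes>\<^bsub>nV n\<^esub> ?conj ?t) + len g"
    by (rule len_mult_ge(2)) (use g t x0 in simp_all)
  ultimately have "\<rho> + len (inv\<^bsub>nV n\<^esub> g) \<le> len (g \<otimes>\<^bsub>nV n\<^esub> ?conj ?t)"
    using x0Q len_t r len_inv[OF g] by (simp add: Q_def)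
  then have "reach \<rho> J (len (inv\<^bsub>nV n\<^esub> g)) (g \<otimes>\<^bsub>nV n\<^esub> ?conj ?t) ((g \<otimes>\<^bsub>nV n\<^esub> ?conj ?t) \<otimes>\<^bsub>nV n\<^esub> inv\<^bsub>nV n\<^esub> g)"
    by (intro reach_word) (use g t x0 J in simp_all)
  moreover have "(g \<otimes>\<^bsub>nV n\<^esub> ?conj ?t) \<otimes>\<^bsub>nV n\<^esub> inv\<^bsub>nV n\<^esub> g = ?conj ?h"
    using g t x0 by (simp add: m_assoc inv_mult_group)
  ultimately have 3: "reach \<rho> J (len g) (g \<otimes>\<^bsub>nV n\<^esub> ?conj ?t) (?conj ?h)"
    using len_inv[OF g] by simp
  \<comment> \<open>\<open>?h\<close> maps the support of \<open>?x0\<close> into one half; the pump of the other half is disjoint from it.\<close>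
  obtain d where d: "d = ?c0 \<or> d = ?c1" and hd: "\<And>\<xi>. \<xi> \<in> rectangle n ?c0 \<Longrightarrow> ?h \<xi> \<notin> rectangle n d"
  proof (cases "g (corner n (half False)) 0 0")
    case True
    have "?h \<xi> \<notin> rectangle n ?c0" if "\<xi> \<in> rectangle n ?c0" for \<xi>
      using pump_into_half[OF g _ that, of k] True r near_corner_half[of n] n C by (auto simp: mem_half k_def)
    then show ?thesis using that by blast
  next
    case False
    have "?h \<xi> \<notin> rectangle n ?c1" if "\<xi> \<in> rectangle n ?c0" for \<xi>
      using pump_into_half[OF g _ that, of k] False r n C by (auto simp: mem_half k_def)
    then show ?thesis using that by blast
  qed
  have Jd: "len (pump n d) \<le> J" using d J by auto
  have "reach \<rho> J (2 * len ?h + 2 * (C * Q)) (\<one>\<^bsub>nV n\<^esub> \<otimes>\<^bsub>nV n\<^esub> ?pow (pump n d)) (\<one>\<^bsub>nV n\<^esub> \<otimes>\<^bsub>nV n\<^esub> ?conj ?h)"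
  proof (rule pump_switch[OF n gen C depth one_closed h J(1) disjI1[OF refl] Jd J(2) hd])
    have "len \<one>\<^bsub>nV n\<^esub> = 0" using len_pow[OF x0, of 0] by simp
    then show "\<rho> + 2 * len ?h + len \<one>\<^bsub>nV n\<^esub> \<le> Q" using len_h by (simp add: Q_def)
  qed
  then have 4: "reach \<rho> J (2 * len ?h + 2 * (C * Q)) (?conj ?h) (?pow (pump n d))"
    using pump_nV h x0 by (simp add: reach_sym)
  have 5: "reach \<rho> J (2 * (C * Q)) (?pow (pump n d)) (?pow ?x1)"
    using d
  proof
    assume d: "d = ?c1"
    show ?thesis unfolding d reach_def by (intro exI[of _ 0]) simp
  next
    assume d: "d = ?c0"
    have one: "len \<one>\<^bsub>nV n\<^esub> = 0" using len_pow[OF x0, of 0] by simp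
    have "reach \<rho> J (2 * len \<one>\<^bsub>nV n\<^esub> + 2 * (C * Q)) (\<one>\<^bsub>nV n\<^esub> \<otimes>\<^bsub>nV n\<^esub> ?pow ?x1) (\<one>\<^bsub>nV n\<^esub> \<otimes>\<^bsub>nV n\<^esub> ?conj \<one>\<^bsub>nV n\<^esub>)"
    proof (rule pump_switch[OF n gen C depth one_closed one_closed J(1) disjI1[OF refl] J(4) J(2)])
      show "\<one>\<^bsub>nV n\<^esub> \<xi> \<notin> rectangle n ?c1" if "\<xi> \<in> rectangle n ?c0" for \<xi>
        using disj01[OF that] that rectangle_subset[of n ?c0] nV_one_apply by (metis subsetD)
      show "\<rho> + 2 * len \<one>\<^bsub>nV n\<^esub> + len \<one>\<^bsub>nV n\<^esub> \<le> Q" using one by (simp add: Q_def)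
    qed
    then show ?thesis using one x0 x1 d by (simp add: reach_sym)
  qed
  show ?thesis
    using reach_trans[OF reach_trans[OF reach_trans[OF reach_trans[OF 1 2] 3] 4] 5]
    by (rule reach_mono) (use len_h len_t r in simp)
qed

end

text \<open>Since \<open>K * \<rho> \<le> r\<close>, the exponents in the previous lemma are linear in \<open>r\<close> alone, and so is the length of
  the detour through the common endpoint \<open>x\<^sub>1\<^bsup>M\<^esup>\<close>.\<close>

theorem nV_linear_divergence:
  assumes n: "1 \<le> n" and gen: "generated_group (nV n) S" and fin: "finite S"
  shows "\<exists>K J A. 1 \<le> K \<and> (\<forall>\<rho> r. \<forall>a\<in>carrier (nV n). \<forall>b\<in>carrier (nV n).
    K * \<rho> \<le> word_length (nV n) S a \<longrightarrow> word_length (nV n) S a \<le> r \<longrightarrow>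
    K * \<rho> \<le> word_length (nV n) S b \<longrightarrow> word_length (nV n) S b \<le> r \<longrightarrow>
    generated_group.reach (nV n) S \<rho> J (A * r) a b)"
proof -
  interpret generated_group "nV n" S by (rule gen)
  obtain C where C: "1 \<le> C" "\<And>g. g \<in> carrier (nV n) \<Longrightarrow> bounded_shift n (C * len g) g"
    using depth_bound[OF n gen fin] by blast
  define J where "J = 1 + len (pump n near_corner) + len (pump n (half False)) + len (pump n (half True))"
  have J: "1 \<le> J" "len (pump n near_corner) \<le> J" "len (pump n (half False)) \<le> J" "len (pump n (half True)) \<le> J"
    by (simp_all add: J_def)
  define A where "A = 7 * (C * (3 + 2 * (C * J))) + 4 * (C * J) + 3"
  have "reach \<rho> J ((2 * A) * r) a b"
    if a: "a \<in> carrier (nV n)" "(1 + C * J) * \<rho> \<le> len a" "len a \<le> r"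
      and b: "b \<in> carrier (nV n)" "(1 + C * J) * \<rho> \<le> len b" "len b \<le> r" for \<rho> r a b
  proof -
    let ?Q = "\<rho> + 2 * r + 2 * (C * r * J)"
    let ?L = "7 * (C * ?Q) + 4 * (C * r * J) + 3 * r"
    have "\<rho> \<le> r" using a(2,3) by simp
    then have "?Q \<le> (3 + 2 * (C * J)) * r" by (simp add: algebra_simps)
    then have "C * ?Q \<le> C * ((3 + 2 * (C * J)) * r)" by (rule mult_le_mono2)
    then have L: "?L \<le> A * r" by (simp add: A_def algebra_simps)
    have "reach \<rho> J ?L a (pump n (half True) [^]\<^bsub>nV n\<^esub> (C * ?Q))"
      by (rule reach_pump_power[OF n gen C a(1) a(3) J a(2)])
    moreover have "reach \<rho> J ?L b (pump n (half True) [^]\<^bsub>nV n\<^esub> (C * ?Q))"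
      by (rule reach_pump_power[OF n gen C b(1) b(3) J b(2)])
    ultimately have "reach \<rho> J (?L + ?L) a b" using reach_trans reach_sym by blast
    moreover have "?L + ?L \<le> 2 * A * r"
      using add_mono[OF L L] by (simp only: mult_2 distrib_right)
    ultimately show ?thesis by (rule reach_mono)
  qed
  then show ?thesis by (intro exI[of _ "1 + C * J"] exI[of _ J] exI[of _ "2 * A"]) simp
qed

section \<open>From linear divergence to asymptotic cones\<close>

lemma nonprincipal_ultrafilter_le_sequentially:
  fixes \<omega> :: "nat filter"
  assumes "nonprincipal_ultrafilter \<omega>"
  shows "\<omega> \<le> sequentially"
proof (rule filter_leI)
  fix P :: "nat \<Rightarrow> bool" assume "eventually P sequentially"
  then obtain N where N: "\<And>k. N \<le> k \<Longrightarrow> P k" unfolding eventually_sequentially by blast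
  have "\<forall>i\<in>{..<N}. eventually (\<lambda>k. k \<noteq> i) \<omega>"
    using assms unfolding nonprincipal_ultrafilter_def by blast
  then have "eventually (\<lambda>k. \<forall>i\<in>{..<N}. k \<noteq> i) \<omega>" by (simp add: eventually_ball_finite)
  then show "eventually P \<omega>"
  proof (rule eventually_mono)
    fix k assume "\<forall>i\<in>{..<N}. k \<noteq> i"
    then have "\<not> k < N" by blast
    then show "P k" using N by simp
  qed
qed

context generated_group
begin

lemma reach_path:
  assumes "reach \<rho> J L a b" and a: "a \<in> carrier G" "\<rho> \<le> len a" and b: "b \<in> carrier G" "\<rho> \<le> len b"
  shows "\<exists>m f. m \<le> L \<and> f 0 = a \<and> f m = b \<and> (\<forall>i\<le>m. f i \<in> carrier G \<and> \<rho> \<le> len (f i)) \<and>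
    (\<forall>i<m. word_dist G S (f i) (f (Suc i)) \<le> real J)"
proof -
  obtain m f where m: "m \<le> L" and f: "f 0 = a" "f m = b" "\<And>i. i < m \<Longrightarrow> (f i, f (Suc i)) \<in> far_steps \<rho> J"
    using assms(1) unfolding reach_def relpow_fun_conv by blast
  have "f i \<in> carrier G \<and> \<rho> \<le> len (f i)" if "i \<le> m" for i
    using f(3)[of i] f(2) b that by (cases "i = m") (auto simp: far_steps_def)
  moreover have "word_dist G S (f i) (f (Suc i)) \<le> real J" if "i < m" for i
    using f(3)[OF that] by (auto simp: far_steps_def word_dist_eq)
  ultimately show ?thesis using m f(1,2) by blast
qed

lemma word_dist_translate:
  assumes "g \<in> carrier G" "a \<in> carrier G" "b \<in> carrier G"
  shows "word_dist G S (g \<otimes> a) (g \<otimes> b) = word_dist G S a b"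
proof -
  have "inv (g \<otimes> a) \<otimes> (g \<otimes> b) = inv a \<otimes> (inv g \<otimes> (g \<otimes> b))" using assms by (simp add: inv_mult_group m_assoc)
  also have "inv g \<otimes> (g \<otimes> b) = b" using assms by (simp flip: m_assoc)
  finally show ?thesis using assms by (simp add: word_dist_eq)
qed

lemma word_dist_chain:
  assumes "\<And>i. i \<le> m \<Longrightarrow> f i \<in> carrier G" and "\<And>i. i < m \<Longrightarrow> word_dist G S (f i) (f (Suc i)) \<le> B"
    and "i \<le> j" "j \<le> m"
  shows "word_dist G S (f i) (f j) \<le> B * real (j - i)"
  using assms(3,4)
proof (induction j rule: dec_induct)
  case base
  then show ?case using dist.zero[of "f i" "f i"] assms(1) by simp
next
  case (step j)
  have "word_dist G S (f i) (f (Suc j)) \<le> word_dist G S (f i) (f j) + word_dist G S (f j) (f (Suc j))"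
    using step assms(1) by (intro dist.triangle) auto
  also have "\<dots> \<le> B * real (j - i) + B" using step assms(2)[of j] by (intro add_mono) auto
  also have "\<dots> = B * real (Suc j - i)" using step by (simp add: Suc_diff_le algebra_simps)
  finally show ?case .
qed

lemma word_dist_len:
  assumes "q \<in> carrier G" "x \<in> carrier G"
  shows "word_dist G S x q = real (len (inv q \<otimes> x))"
  using assms dist.commute[of x q] by (simp add: word_dist_eq)

text \<open>A coarse path of \<open>m\<close> steps, parametrised over the unit interval. The additive constant comes from
  rounding and becomes negligible after rescaling.\<close>

lemma floor_path:
  assumes path: "\<And>i. i \<le> m \<Longrightarrow> f i \<in> carrier G" "\<And>i. i < m \<Longrightarrow> word_dist G S (f i) (f (Suc i)) \<le> B"
    and B: "0 \<le> B" and s: "s \<in> {0..1}" "t \<in> {0..1}"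
  shows "word_dist G S (f (nat \<lfloor>s * real m\<rfloor>)) (f (nat \<lfloor>t * real m\<rfloor>)) \<le> B * (\<bar>s - t\<bar> * real m + 1)"
proof -
  have le: "nat \<lfloor>s * real m\<rfloor> \<le> m" if "s \<in> {0..1}" for s
  proof -
    have "s * real m \<le> 1 * real m" using that by (intro mult_right_mono) auto
    then show ?thesis by linarith
  qed
  have *: "word_dist G S (f (nat \<lfloor>s * real m\<rfloor>)) (f (nat \<lfloor>t * real m\<rfloor>)) \<le> B * (\<bar>s - t\<bar> * real m + 1)"
    if st: "s \<in> {0..1}" "t \<in> {0..1}" "s \<le> t" for s t
  proof -
    have 1: "s * real m \<le> t * real m" "0 \<le> s * real m" using st by (auto intro: mult_right_mono)
    then have "nat \<lfloor>s * real m\<rfloor> \<le> nat \<lfloor>t * real m\<rfloor>" by linarith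
    from word_dist_chain[of m f B "nat \<lfloor>s * real m\<rfloor>" "nat \<lfloor>t * real m\<rfloor>", OF path this le[OF st(2)]]
    have "word_dist G S (f (nat \<lfloor>s * real m\<rfloor>)) (f (nat \<lfloor>t * real m\<rfloor>))
      \<le> B * real (nat \<lfloor>t * real m\<rfloor> - nat \<lfloor>s * real m\<rfloor>)" by simp
    also have "\<dots> \<le> B * (t * real m - s * real m + 1)" using 1 by (intro mult_left_mono B) linarith
    also have "t * real m - s * real m = \<bar>s - t\<bar> * real m" using st(3) by (simp add: algebra_simps)
    finally show ?thesis .
  qed
  show ?thesis
  proof (cases "s \<le> t")
    case False
    then show ?thesis using *[OF s(2) s(1)] dist.commute by (simp add: abs_minus_commute)
  qed (rule *[OF s])
qed

context
  fixes \<omega> :: "nat filter" and e :: "nat \<Rightarrow> 'a" and \<delta> :: "nat \<Rightarrow> real"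
  assumes u: "nonprincipal_ultrafilter \<omega>" and e: "\<And>k. e k \<in> carrier G"
    and \<delta>: "\<And>k. \<delta> k > 0" and \<delta>_top: "filterlim \<delta> at_top sequentially"
begin

abbreviation "scaled_dist \<equiv> \<lambda>k g h. word_dist G S g h / \<delta> k"
abbreviation "limit_cone \<equiv> asymptotic_cone G S \<omega> e \<delta>"
abbreviation "limit_dist \<equiv> asymptotic_cone_dist G S \<omega> e \<delta>"
abbreviation "seqs \<equiv> bounded_seqs \<omega> (\<lambda>_. carrier G) scaled_dist e"

lemma scaled: "Metric_space (carrier G) (scaled_dist k)"
proof
  show "0 \<le> scaled_dist k x y" for x y using \<delta>[of k] by simp
  show "scaled_dist k x y = scaled_dist k y x" for x y by (simp add: dist.commute)
  show "scaled_dist k x y = 0 \<longleftrightarrow> x = y" if "x \<in> carrier G" "y \<in> carrier G" for x y using \<delta>[of k] that by simp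
  show "scaled_dist k x z \<le> scaled_dist k x y + scaled_dist k y z" if "x \<in> carrier G" "y \<in> carrier G" "z \<in> carrier G" for x y z
    using dist.triangle[OF that] \<delta>[of k] by (simp add: divide_right_mono flip: add_divide_distrib)
qed

lemma cone_metric: "Metric_space limit_cone limit_dist"
  unfolding asymptotic_cone_def asymptotic_cone_dist_def by (rule ultralimit_Metric_space[OF u scaled e])

lemma cone_tendsto:
  assumes "a \<in> limit_cone" "b \<in> limit_cone" "x \<in> a" "y \<in> b"
  shows "((\<lambda>k. scaled_dist k (x k) (y k)) \<longlongrightarrow> limit_dist a b) \<omega>"
  using assms unfolding asymptotic_cone_def asymptotic_cone_dist_def
  by (rule ultralimit_dist_tendsto[where X = "\<lambda>_. carrier G" and d = scaled_dist and e = e, OF u scaled e])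

lemma cone_equiv: "equiv seqs (ultralimit_rel \<omega> (\<lambda>_. carrier G) scaled_dist e)"
  by (rule ultralimit_rel_equiv[where X = "\<lambda>_. carrier G" and d = scaled_dist and e = e, OF u scaled e])

lemma cone_rep:
  assumes "a \<in> limit_cone" shows "\<exists>x. x \<in> a" "x \<in> a \<Longrightarrow> x \<in> seqs"
  using assms in_quotient_imp_non_empty[OF cone_equiv] in_quotient_imp_subset[OF cone_equiv]
  unfolding asymptotic_cone_def ultralimit_def by blast+

lemma cone_class:
  assumes "x \<in> seqs" shows "\<exists>a\<in>limit_cone. x \<in> a"
  unfolding asymptotic_cone_def ultralimit_def
  using quotientI[OF assms] equiv_class_self[OF cone_equiv assms] by blast

lemma omega_bot: "\<omega> \<noteq> bot"
  using u by (simp add: nonprincipal_ultrafilter_def)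

lemma scale_top: "filterlim \<delta> at_top \<omega>"
  by (rule filterlim_mono[OF \<delta>_top order_refl nonprincipal_ultrafilter_le_sequentially[OF u]])

lemma inverse_scale: "((\<lambda>k. B / \<delta> k) \<longlongrightarrow> 0) \<omega>"
  by (rule tendsto_divide_0[OF tendsto_const]) (rule filterlim_at_top_imp_at_infinity[OF scale_top])

text \<open>Two points \<open>a\<close> and \<open>b\<close> of the cone that differ from \<open>p\<close> are at distances from \<open>p\<close> between two positive
  constants. After translating \<open>p\<close> to the identity, they are represented by elements to which the
  divergence hypothesis applies at scale \<open>\<delta> k\<close>, for almost all \<open>k\<close>. The resulting coarse paths have
  linear length and avoid a ball of linear radius, so they converge to a Lipschitz path from \<open>a\<close> to
  \<open>b\<close> that avoids \<open>p\<close>.\<close>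

lemma no_cut_point:
  assumes K: "1 \<le> K" and div: "\<And>\<rho> r a b. a \<in> carrier G \<Longrightarrow> b \<in> carrier G \<Longrightarrow>
      K * \<rho> \<le> len a \<Longrightarrow> len a \<le> r \<Longrightarrow> K * \<rho> \<le> len b \<Longrightarrow> len b \<le> r \<Longrightarrow> reach \<rho> J (A * r) a b"
  shows "\<not> cut_point limit_cone limit_dist p"
proof
  assume cut: "cut_point limit_cone limit_dist p"
  then have p: "p \<in> limit_cone" by (simp add: cut_point_def)
  interpret limit_cone: Metric_space limit_cone limit_dist by (rule cone_metric)
  obtain q where q: "q \<in> p" using cone_rep(1)[OF p] by blast
  have qc: "q k \<in> carrier G" for k using cone_rep(2)[OF p q] by (simp add: bounded_seqs_def)
  have "\<exists>g. pathin (subtopology limit_cone.mtopology (limit_cone - {p})) g \<and> g 0 = a \<and> g 1 = b"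
    if a: "a \<in> limit_cone" "a \<noteq> p" and b: "b \<in> limit_cone" "b \<noteq> p" for a b
  proof -
    obtain x y where x: "x \<in> a" and y: "y \<in> b" using cone_rep(1) a(1) b(1) by blast
    have xs: "x \<in> seqs" and xc: "\<And>k. x k \<in> carrier G" and yc: "\<And>k. y k \<in> carrier G"
      using cone_rep(2)[OF a(1) x] cone_rep(2)[OF b(1) y] by (auto simp: bounded_seqs_def)
    define \<epsilon> where "\<epsilon> = min (limit_dist a p) (limit_dist b p) / 2"
    define R where "R = max (limit_dist a p) (limit_dist b p) + 1"
    have pos: "0 < limit_dist a p" "0 < limit_dist b p" using a b p limit_cone.mdist_pos_less by auto
    then have \<epsilon>: "0 < \<epsilon>" "\<epsilon> < limit_dist a p" "\<epsilon> < limit_dist b p" and R: "0 < R" "limit_dist a p < R" "limit_dist b p < R"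
      by (auto simp: \<epsilon>_def R_def)
    note tx = cone_tendsto[OF a(1) p x q] and ty = cone_tendsto[OF b(1) p y q]
    define good where "good k \<longleftrightarrow> \<epsilon> < scaled_dist k (x k) (q k) \<and> scaled_dist k (x k) (q k) < R \<and>
      \<epsilon> < scaled_dist k (y k) (q k) \<and> scaled_dist k (y k) (q k) < R \<and> 1 \<le> \<delta> k" for k
    have good: "eventually good \<omega>"
      unfolding good_def
      by (intro eventually_conj order_tendstoD[OF tx] order_tendstoD[OF ty] \<epsilon> R)
        (use scale_top in \<open>simp add: filterlim_at_top\<close>)
    define r where "r k = nat \<lceil>R * \<delta> k\<rceil>" for k
    define \<rho> where "\<rho> k = nat \<lfloor>\<epsilon> * \<delta> k / K\<rfloor>" for k
    define Q where "Q k m f \<longleftrightarrow> m \<le> A * r k \<and> f 0 = x k \<and> f m = y k \<and>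
      (\<forall>i\<le>m. f i \<in> carrier G \<and> real (\<rho> k) \<le> word_dist G S (f i) (q k)) \<and>
      (\<forall>i<m. word_dist G S (f i) (f (Suc i)) \<le> real J)" for k m f
    have "\<exists>mf. good k \<longrightarrow> Q k (fst mf) (snd mf)" for k
    proof (cases "good k")
      case True
      let ?x = "inv (q k) \<otimes> x k" and ?y = "inv (q k) \<otimes> y k"
      have c: "?x \<in> carrier G" "?y \<in> carrier G" using qc xc yc by simp_all
      have K0: "0 < real K" using K by simp
      have bnd: "K * \<rho> k \<le> len (inv (q k) \<otimes> z) \<and> len (inv (q k) \<otimes> z) \<le> r k \<and> \<rho> k \<le> len (inv (q k) \<otimes> z)"
        if z: "z \<in> carrier G" "\<epsilon> < scaled_dist k z (q k)" "scaled_dist k z (q k) < R" for z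
      proof -
        have l: "\<epsilon> * \<delta> k < len (inv (q k) \<otimes> z)" "len (inv (q k) \<otimes> z) < R * \<delta> k"
          using z \<delta>[of k] qc word_dist_len by (simp_all add: field_simps)
        have "real (\<rho> k) \<le> \<epsilon> * \<delta> k / K" using \<epsilon>(1) \<delta>[of k] by (simp add: \<rho>_def)
        then have "real K * real (\<rho> k) \<le> \<epsilon> * \<delta> k" using K0 by (simp add: field_simps)
        then have "real (K * \<rho> k) \<le> real (len (inv (q k) \<otimes> z))" using l(1) by simp
        then have 1: "K * \<rho> k \<le> len (inv (q k) \<otimes> z)" by (simp only: of_nat_le_iff)
        moreover have "\<rho> k \<le> K * \<rho> k" using K by simp
        moreover have "len (inv (q k) \<otimes> z) \<le> r k" using l(2) unfolding r_def by linarith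
        ultimately show ?thesis by linarith
      qed
      have bx: "K * \<rho> k \<le> len ?x" "len ?x \<le> r k" "\<rho> k \<le> len ?x"
        and by': "K * \<rho> k \<le> len ?y" "len ?y \<le> r k" "\<rho> k \<le> len ?y"
        using bnd[OF xc] bnd[OF yc] True by (simp_all add: good_def)
      from reach_path[OF div[OF c bx(1,2) by'(1,2)] c(1) bx(3) c(2) by'(3)]
      obtain m f where f: "m \<le> A * r k" "f 0 = ?x" "f m = ?y" "\<And>i. i \<le> m \<Longrightarrow> f i \<in> carrier G"
        "\<And>i. i \<le> m \<Longrightarrow> \<rho> k \<le> len (f i)" "\<And>i. i < m \<Longrightarrow> word_dist G S (f i) (f (Suc i)) \<le> real J" by blast
      have "q k \<otimes> (inv (q k) \<otimes> z) = z" "inv (q k) \<otimes> (q k \<otimes> z) = z" if "z \<in> carrier G" for z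
        using qc[of k] that by (simp_all flip: m_assoc)
      then have "Q k m (\<lambda>i. q k \<otimes> f i)"
        unfolding Q_def using f xc yc qc by (simp add: word_dist_len[of "q k"] word_dist_translate)
      then show ?thesis by (intro exI[of _ "(m, \<lambda>i. q k \<otimes> f i)"]) simp
    qed simp
    then have "\<forall>k. \<exists>mf. good k \<longrightarrow> Q k (fst mf) (snd mf)" by blast
    from choice[OF this] obtain mf where "\<And>k. good k \<Longrightarrow> Q k (fst (mf k)) (snd (mf k))" by blast
    then obtain m f where Q: "\<And>k. good k \<Longrightarrow> Q k (m k) (f k)" by (metis that[of "\<lambda>k. fst (mf k)" "\<lambda>k. snd (mf k)"])
    define c where "c s k = (if good k then f k (nat \<lfloor>s * real (m k)\<rfloor>) else x k)" for s :: real and k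
    have idx: "nat \<lfloor>s * real l\<rfloor> \<le> l" if "s \<in> {0..1}" for s and l :: nat
    proof -
      have "s * real l \<le> 1 * real l" using that by (intro mult_right_mono) auto
      then show ?thesis by linarith
    qed
    have cc: "c s k \<in> carrier G" if "s \<in> {0..1}" for s k
      using Q[of k] idx[OF that] xc by (auto simp: c_def Q_def)
    define \<Lambda> where "\<Lambda> = real J * (real A * (R + 1))"
    have \<Lambda>: "0 \<le> \<Lambda>" using R by (simp add: \<Lambda>_def)
    have lip: "scaled_dist k (c s k) (c t k) \<le> \<Lambda> * \<bar>s - t\<bar> + real J / \<delta> k"
      if k: "good k" and st: "s \<in> {0..1}" "t \<in> {0..1}" for k s t
    proof -
      have \<delta>1: "1 \<le> \<delta> k" using k by (simp add: good_def)
      have "real (r k) \<le> R * \<delta> k + 1" using R \<delta>[of k] unfolding r_def by simp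
      also have "\<dots> \<le> (R + 1) * \<delta> k" using \<delta>1 by (simp add: algebra_simps)
      finally have "real A * real (r k) \<le> real A * ((R + 1) * \<delta> k)" by (intro mult_left_mono) simp_all
      moreover have "real (m k) \<le> real A * real (r k)" using Q[OF k] by (simp add: Q_def flip: of_nat_mult)
      ultimately have m: "real (m k) \<le> real A * (R + 1) * \<delta> k" by simp
      have "word_dist G S (c s k) (c t k) \<le> real J * (\<bar>s - t\<bar> * real (m k) + 1)"
        using floor_path[of "m k" "f k" "real J" s t] Q[OF k] k st by (simp add: c_def Q_def)
      also have "\<dots> \<le> real J * (\<bar>s - t\<bar> * (real A * (R + 1) * \<delta> k) + 1)"
        using m by (intro mult_left_mono add_right_mono) simp_all
      also have "\<dots> = (\<Lambda> * \<bar>s - t\<bar>) * \<delta> k + real J" by (simp add: \<Lambda>_def algebra_simps)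
      finally have "scaled_dist k (c s k) (c t k) \<le> ((\<Lambda> * \<bar>s - t\<bar>) * \<delta> k + real J) / \<delta> k"
        using \<delta>[of k] by (simp add: divide_right_mono)
      also have "\<dots> = \<Lambda> * \<bar>s - t\<bar> + real J / \<delta> k" using \<delta>[of k] by (simp add: field_simps)
      finally show ?thesis .
    qed
    have c0: "c 0 k = x k" for k using Q[of k] by (simp add: c_def Q_def)
    have cs: "c s \<in> seqs" if s: "s \<in> {0..1}" for s
    proof -
      obtain B where B: "eventually (\<lambda>k. scaled_dist k (x k) (e k) \<le> B) \<omega>" using xs by (auto simp: bounded_seqs_def)
      have "eventually (\<lambda>k. scaled_dist k (c s k) (e k) \<le> \<Lambda> + real J + B) \<omega>"
        using eventually_conj[OF good B]
      proof (rule eventually_mono)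
        fix k assume k: "good k \<and> scaled_dist k (x k) (e k) \<le> B"
        then have \<delta>1: "1 \<le> \<delta> k" by (simp add: good_def)
        have "scaled_dist k (c s k) (e k) \<le> scaled_dist k (c s k) (x k) + scaled_dist k (x k) (e k)"
          by (rule Metric_space.triangle[OF scaled]) (use cc[OF s] xc e in simp_all)
        moreover have "scaled_dist k (c s k) (x k) \<le> \<Lambda> * \<bar>s - 0\<bar> + real J / \<delta> k"
          using lip[of k s 0] k s c0 by simp
        moreover have "\<Lambda> * \<bar>s - 0\<bar> \<le> \<Lambda> * 1" using s \<Lambda> by (intro mult_left_mono) auto
        moreover have "real J / \<delta> k \<le> real J / 1" using \<delta>1 by (intro divide_left_mono) auto
        ultimately show "scaled_dist k (c s k) (e k) \<le> \<Lambda> + real J + B" using k by simp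
      qed
      then show ?thesis using cc[OF s] by (auto simp: bounded_seqs_def)
    qed
    have "\<forall>s\<in>{0..1}. \<exists>z. z \<in> limit_cone \<and> c s \<in> z" using cone_class cs by blast
    from bchoice[OF this] obtain g where g: "\<And>s. s \<in> {0..1} \<Longrightarrow> g s \<in> limit_cone" "\<And>s. s \<in> {0..1} \<Longrightarrow> c s \<in> g s" by blast
    have g_lip: "limit_dist (g s) (g t) \<le> \<Lambda> * \<bar>s - t\<bar>" if st: "s \<in> {0..1}" "t \<in> {0..1}" for s t
    proof -
      have "((\<lambda>k. \<Lambda> * \<bar>s - t\<bar> + real J / \<delta> k) \<longlongrightarrow> \<Lambda> * \<bar>s - t\<bar> + 0) \<omega>"
        by (intro tendsto_add tendsto_const inverse_scale)
      from tendsto_le[OF omega_bot this cone_tendsto[OF g(1)[OF st(1)] g(1)[OF st(2)] g(2)[OF st(1)] g(2)[OF st(2)]]]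
      show ?thesis using eventually_mono[OF good lip[OF _ st]] by simp
    qed
    have g_far: "g s \<noteq> p" if s: "s \<in> {0..1}" for s
    proof -
      have "((\<lambda>k. \<epsilon> / K - 1 / \<delta> k) \<longlongrightarrow> \<epsilon> / K - 0) \<omega>"
        by (intro tendsto_diff tendsto_const inverse_scale)
      moreover have "eventually (\<lambda>k. \<epsilon> / K - 1 / \<delta> k \<le> scaled_dist k (c s k) (q k)) \<omega>"
        using good
      proof (rule eventually_mono)
        fix k assume k: "good k"
        have "real (\<rho> k) \<le> word_dist G S (c s k) (q k)"
          using Q[OF k] idx[OF s] k by (simp add: Q_def c_def)
        moreover have "\<epsilon> * \<delta> k / K - 1 \<le> real (\<rho> k)" unfolding \<rho>_def by linarith
        ultimately have "(\<epsilon> * \<delta> k / K - 1) / \<delta> k \<le> scaled_dist k (c s k) (q k)"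
          using \<delta>[of k] by (intro divide_right_mono) simp_all
        then show "\<epsilon> / K - 1 / \<delta> k \<le> scaled_dist k (c s k) (q k)" using \<delta>[of k] by (simp add: diff_divide_distrib)
      qed
      ultimately have "\<epsilon> / K - 0 \<le> limit_dist (g s) p"
        by (rule tendsto_le[OF omega_bot cone_tendsto[OF g(1)[OF s] p g(2)[OF s] q]])
      moreover have "0 < \<epsilon> / K" using \<epsilon> K by simp
      ultimately show ?thesis using p by auto
    qed
    have g0: "g 0 = a"
    proof -
      have "((\<lambda>k. scaled_dist k (c 0 k) (x k)) \<longlongrightarrow> 0) \<omega>" using xc c0 by simp
      then have "limit_dist (g 0) a = 0" using cone_tendsto[OF g(1)[of 0] a(1) g(2)[of 0] x] tendsto_unique[OF omega_bot] by force
      then show ?thesis using g(1)[of 0] a(1) by simp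
    qed
    have g1: "g 1 = b"
    proof -
      have "eventually (\<lambda>k. scaled_dist k (c 1 k) (y k) = 0) \<omega>"
        by (rule eventually_mono[OF good]) (use Q yc in \<open>auto simp: c_def Q_def\<close>)
      then have "((\<lambda>k. scaled_dist k (c 1 k) (y k)) \<longlongrightarrow> 0) \<omega>" by (rule tendsto_eventually)
      then have "limit_dist (g 1) b = 0" using cone_tendsto[OF g(1)[of 1] b(1) g(2)[of 1] y] tendsto_unique[OF omega_bot] by force
      then show ?thesis using g(1)[of 1] b(1) by simp
    qed
    have "continuous_map (top_of_set {0..1}) limit_cone.mtopology g"
      unfolding limit_cone.continuous_map_to_metric
    proof (intro ballI allI impI)
      fix s \<eta> :: real assume s: "s \<in> topspace (top_of_set {0..1})" and \<eta>: "0 < \<eta>"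
      let ?U = "{0..1} \<inter> ball s (\<eta> / (\<Lambda> + 1))"
      have "g t \<in> limit_cone.mball (g s) \<eta>" if t: "t \<in> ?U" for t
      proof -
        have "\<bar>s - t\<bar> < \<eta> / (\<Lambda> + 1)" using t by (simp add: dist_real_def)
        then have "(\<Lambda> + 1) * \<bar>s - t\<bar> < \<eta>" using \<Lambda> by (simp add: field_simps)
        moreover have "limit_dist (g s) (g t) \<le> \<Lambda> * \<bar>s - t\<bar>" using g_lip s t by simp
        moreover have "\<Lambda> * \<bar>s - t\<bar> \<le> (\<Lambda> + 1) * \<bar>s - t\<bar>" by (intro mult_right_mono) simp_all
        ultimately show ?thesis using g(1) s t by simp
      qed
      moreover have "openin (top_of_set {0..1}) ?U" by (rule openin_open_Int) simp
      moreover have "s \<in> ?U" using s \<eta> \<Lambda> by simp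
      ultimately show "\<exists>U. openin (top_of_set {0..1}) U \<and> s \<in> U \<and> (\<forall>t\<in>U. g t \<in> limit_cone.mball (g s) \<eta>)" by blast
    qed
    then have "pathin (subtopology limit_cone.mtopology (limit_cone - {p})) g"
      unfolding pathin_def continuous_map_in_subtopology using g(1) g_far by auto
    then show ?thesis using g0 g1 by blast
  qed
  then have "path_connected_space (subtopology limit_cone.mtopology (limit_cone - {p}))"
    unfolding path_connected_space_def by simp
  then show False using cut by (simp add: cut_point_def)
qed

end

end

theorem mainTheorem2:
  fixes n :: nat
    and S :: "((nat \<Rightarrow> bool word) \<Rightarrow> (nat \<Rightarrow> bool word)) set"
    and \<omega> :: "nat filter"
    and e :: "nat \<Rightarrow> ((nat \<Rightarrow> bool word) \<Rightarrow> (nat \<Rightarrow> bool word))"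
    and \<delta> :: "nat \<Rightarrow> real"
  assumes "n \<ge> 2"
    and "finite S" and "S \<subseteq> carrier (nV n)" and "generate (nV n) S = carrier (nV n)"
    and "nonprincipal_ultrafilter \<omega>"
    and "\<And>k. e k \<in> carrier (nV n)"
    and "\<And>k. \<delta> k > 0" and "filterlim \<delta> at_top sequentially"
  shows "\<not> (\<exists>p. cut_point (asymptotic_cone (nV n) S \<omega> e \<delta>) (asymptotic_cone_dist (nV n) S \<omega> e \<delta>) p)"
proof -
  have gen: "generated_group (nV n) S"
    using assms(3,4) nV_group by (simp add: generated_group_def generated_group_axioms_def)
  have "1 \<le> n" using assms(1) by simp
  from nV_linear_divergence[OF this gen assms(2)]
  obtain K J A where K: "1 \<le> K" and div: "\<And>\<rho> r a b. a \<in> carrier (nV n) \<Longrightarrow> b \<in> carrier (nV n) \<Longrightarrow>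
      K * \<rho> \<le> word_length (nV n) S a \<Longrightarrow> word_length (nV n) S a \<le> r \<Longrightarrow>
      K * \<rho> \<le> word_length (nV n) S b \<Longrightarrow> word_length (nV n) S b \<le> r \<Longrightarrow>
      generated_group.reach (nV n) S \<rho> J (A * r) a b" by blast
  have "\<not> cut_point (asymptotic_cone (nV n) S \<omega> e \<delta>) (asymptotic_cone_dist (nV n) S \<omega> e \<delta>) p" for p
    by (rule generated_group.no_cut_point[OF gen, where K = K and J = J and A = A]) (fact assms K div)+
  then show ?thesis by blast
qed

end
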